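(* Let $S\in\mathbb{R}^{n\times p}$ with $n\ge p$ have singular values $\sigma_1\ge\cdots\ge\sigma_p\ge0$, let $1\le k<p$ with $\operatorname{rank}(S)\ge k$, and let $f\ge1$. The strong rank-revealing QR algorithm (defined in the context) with input $S,k,f$ computes a pivoted QR decomposition $$SP=\begin{bmatrix}S_1&S_2\end{bmatrix}=\begin{bmatrix}Q_1&Q_2\end{bmatrix}\begin{bmatrix}R_{11}&R_{12}\\0&R_{22}\end{bmatrix},$$ where $R_{11}\in\mathbb{R}^{k\times k}$ and $R_{22}\in\mathbb{R}^{(p-k)\times(p-k)}$ satisfy $$\sigma_i(R_{11})\ge\frac{\sigma_i}{\sqrt{1+f^2k(p-k)}},\qquad 1\le i\le k,$$ $$\sigma_j(R_{22})\le\sigma_{j+k}\sqrt{1+f^2k(p-k)},\qquad 1\le j\le p-k,$$ and $$\left|(R_{11}^{-1}R_{12})_{ij}\right|\le f,\qquad 1\le i\le k,\ 1\le j\le p-k.$$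
   Context: All computations are in exact arithmetic. $\|\cdot\|_2$ is the Euclidean norm, $e_i$ is a canonical vector of appropriate length, and $\sigma_j(M)$ is the $j$th largest singular value of $M$. A pivoted QR decomposition of $S\in\mathbb{R}^{n\times p}$ ($n\ge p$) is $SP=QR$ with $P\in\mathbb{R}^{p\times p}$ a permutation matrix, $Q\in\mathbb{R}^{n\times p}$ with orthonormal columns, and $R\in\mathbb{R}^{p\times p}$ upper triangular; it is unpivoted if $P$ is the identity. QR decompositions are computed so that upper triangular factors have non-negative diagonal elements. $S_1$ and $Q_1$ have $k$ columns. Strong rank-revealing QR algorithm (input: $S\in\mathbb{R}^{n\times p}$, $n\ge p$, $1\le k<p$, $f\ge1$; output: $P,Q,R$). Compute a pivoted QR decomposition $SP=QR$ with $R=\begin{bmatrix}R_{11}&R_{12}\\0&R_{22}\end{bmatrix}$ for which $R_{11}\in\mathbb{R}^{k\times k}$ is nonsingular. For the current $R$ define $$\rho_{ij}=\sqrt{\left((R_{11}^{-1}R_{12})_{ij}\right)^2+\left(\|R_{22}e_j\|_2\,\|e_i^TR_{11}^{-1}\|_2\right)^2},\qquad 1\le i\le k,\ 1\le j\le p-k.$$ While $\max_{1\le i\le k,\,1\le j\le p-k}\rho_{ij}>f$: find some $1\le i\le k$, $1\le j\le p-k$ with $\rho_{ij}>f$; let $P^{(ij)}$ be the permutation matrix exchanging columns $i$ and $j+k$; compute an unpivoted QR decomposition $RP^{(ij)}=\widetilde Q\widetilde R$; update $P:=PP^{(ij)}$, $Q:=Q\widetilde Q$, $R:=\widetilde R$,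 and recompute all $\rho_{ij}$. Any admissible choices are allowed. *)

theory Defs
  imports
    "Jordan_Normal_Form.DL_Rank"
    "Jordan_Normal_Form.Char_Poly"
    "HOL-Computational_Algebra.Polynomial"
    "HOL-Combinatorics.Permutations"
begin

text \<open>Matrix and vector entries are indexed from 0, singular values from 1.\<close>

definition vec_norm2 :: "real vec \<Rightarrow> real" where
  "vec_norm2 v = sqrt (v \<bullet> v)"

text \<open>The singular values of \<open>M\<close> are the square roots of the eigenvalues of \<open>M\<^sup>T M\<close>, with
  (algebraic) multiplicity, in non-increasing order. For matrices with more columns than rows only
  the first \<open>dim_row M\<close> of them count; the remaining ones are zero.\<close>

definition singular_values :: "real mat \<Rightarrow> real list" where
  "singular_values M = take (min (dim_row M) (dim_col M))
     (rev (sorted_list_of_multiset (image_mset sqrt (proots (char_poly (transpose_mat M * M))))))"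

definition singular_value :: "nat \<Rightarrow> real mat \<Rightarrow> real" where
  "singular_value j M = singular_values M ! (j - 1)"

definition permutation_mat :: "nat \<Rightarrow> real mat \<Rightarrow> bool" where
  "permutation_mat p P \<longleftrightarrow>
     (\<exists>\<pi>. \<pi> permutes {..<p} \<and> P = mat p p (\<lambda>(i, j). if i = \<pi> j then 1 else 0))"

definition append_cols :: "'a :: zero mat \<Rightarrow> 'a mat \<Rightarrow> 'a mat" where
  "append_cols A B = four_block_mat A B (0\<^sub>m 0 (dim_col A)) (0\<^sub>m 0 (dim_col B))"

text \<open>The convention that the triangular factor has a non-negative diagonal is part of the
  definition.\<close>

definition pivoted_qr :: "real mat \<Rightarrow> real mat \<Rightarrow> real mat \<Rightarrow> real mat \<Rightarrow> bool" where
  "pivoted_qr A P Q R \<longleftrightarrow>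
     (let n = dim_row A; p = dim_col A in
       permutation_mat p P \<and>
       Q \<in> carrier_mat n p \<and> transpose_mat Q * Q = 1\<^sub>m p \<and>
       R \<in> carrier_mat p p \<and> upper_triangular R \<and> (\<forall>i<p. 0 \<le> R $$ (i, i)) \<and>
       A * P = Q * R)"

definition unpivoted_qr :: "real mat \<Rightarrow> real mat \<Rightarrow> real mat \<Rightarrow> bool" where
  "unpivoted_qr A Q R \<longleftrightarrow> pivoted_qr A (1\<^sub>m (dim_col A)) Q R"

definition block11 :: "nat \<Rightarrow> real mat \<Rightarrow> real mat" where
  "block11 k R = (case split_block R k k of (R11, R12, R21, R22) \<Rightarrow> R11)"

definition block12 :: "nat \<Rightarrow> real mat \<Rightarrow> real mat" where
  "block12 k R = (case split_block R k k of (R11, R12, R21, R22) \<Rightarrow> R12)"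

definition block22 :: "nat \<Rightarrow> real mat \<Rightarrow> real mat" where
  "block22 k R = (case split_block R k k of (R11, R12, R21, R22) \<Rightarrow> R22)"

text \<open>\<open>the (mat_inverse A)\<close> is the inverse of a nonsingular \<open>A\<close> and unspecified otherwise.\<close>

definition srrqr_rho :: "nat \<Rightarrow> real mat \<Rightarrow> nat \<Rightarrow> nat \<Rightarrow> real" where
  "srrqr_rho k R i j =
     (let N = the (mat_inverse (block11 k R)) in
       sqrt (((N * block12 k R) $$ (i, j))\<^sup>2
             + (vec_norm2 (col (block22 k R) j) * vec_norm2 (row N i))\<^sup>2))"

text \<open>The algorithm is a nondeterministic transition system on triples \<open>(P, Q, R)\<close>, so that all
  admissible choices of the initial decomposition, of the pair \<open>(i, j)\<close> and of the QR
  decomposition in each step are covered.\<close>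

type_synonym srrqr_state = "real mat \<times> real mat \<times> real mat"

definition srrqr_initial :: "real mat \<Rightarrow> nat \<Rightarrow> srrqr_state \<Rightarrow> bool" where
  "srrqr_initial S k = (\<lambda>(P, Q, R). pivoted_qr S P Q R \<and> invertible_mat (block11 k R))"

inductive srrqr_step :: "nat \<Rightarrow> real \<Rightarrow> srrqr_state \<Rightarrow> srrqr_state \<Rightarrow> bool" for k f where
  "i < k \<Longrightarrow> j < p - k \<Longrightarrow> p = dim_col R \<Longrightarrow> srrqr_rho k R i j > f \<Longrightarrow>
   Pij = swaprows_mat p i (j + k) \<Longrightarrow> unpivoted_qr (R * Pij) Qt Rt \<Longrightarrow>
   srrqr_step k f (P, Q, R) (P * Pij, Q * Qt, Rt)"

definition srrqr_reachable :: "real mat \<Rightarrow> nat \<Rightarrow> real \<Rightarrow> srrqr_state \<Rightarrow> bool" where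
  "srrqr_reachable S k f s \<longleftrightarrow> (\<exists>s0. srrqr_initial S k s0 \<and> (srrqr_step k f)\<^sup>*\<^sup>* s0 s)"

definition srrqr_terminates :: "real mat \<Rightarrow> nat \<Rightarrow> real \<Rightarrow> bool" where
  "srrqr_terminates S k f \<longleftrightarrow>
     \<not> (\<exists>s. srrqr_initial S k (s 0) \<and> (\<forall>t::nat. srrqr_step k f (s t) (s (Suc t))))"

text \<open>Outputs are characterised by the exit condition of the loop, not by the absence of a
  successor state.\<close>

definition srrqr_output ::
  "real mat \<Rightarrow> nat \<Rightarrow> real \<Rightarrow> real mat \<Rightarrow> real mat \<Rightarrow> real mat \<Rightarrow> bool" where
  "srrqr_output S k f P Q R \<longleftrightarrow>
     srrqr_reachable S k f (P, Q, R) \<and>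
     \<not> Max {srrqr_rho k R i j | i j. i < k \<and> j < dim_col R - k} > f"

end

theory Submission
  imports Defs
begin

text \<open>
  Two observations carry the proof; both concern the current factor
  \<open>R = [R11, R12; 0, R22]\<close>.

  Progress. As \<open>Q\<close> has orthonormal columns, \<open>(det R11)\<^sup>2\<close> is the Gram determinant of the first
  \<open>k\<close> columns of \<open>S P\<close>, so it depends on the permutation \<open>P\<close> alone. Exchanging columns \<open>i\<close> and
  \<open>j + k\<close> multiplies this determinant by exactly \<open>\<rho>\<^sub>i\<^sub>j\<^sup>2\<close> (lemma \<open>gram_det_swap\<close>). An iteration is
  carried out only if \<open>\<rho>\<^sub>i\<^sub>j > f \<ge> 1\<close>, so the determinant grows strictly along every run. Hence
  \<open>R11\<close> stays nonsingular, no permutation occurs twice, and, there being finitely many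
  permutations, the algorithm stops.

  Bounds. When it stops, all \<open>\<rho>\<^sub>i\<^sub>j\<close> are at most \<open>f\<close>. Writing \<open>X = R11\<^sup>-\<^sup>1 R12\<close>, the squares of the
  \<open>\<rho>\<^sub>i\<^sub>j\<close> add up to \<open>\<parallel>X\<parallel>\<^sup>2 + \<parallel>R11\<^sup>-\<^sup>1\<parallel>\<^sup>2 \<parallel>R22\<parallel>\<^sup>2\<close> in Frobenius norms, which is therefore at most
  \<open>f\<^sup>2 k (p - k)\<close>. The shear \<open>(a, d) \<mapsto> (a + X d, d)\<close> decouples the two blocks,
  \<open>\<parallel>R (a, d)\<parallel>\<^sup>2 = \<parallel>R11 (a + X d)\<parallel>\<^sup>2 + \<parallel>R22 d\<parallel>\<^sup>2\<close>, and distorts lengths by an amount that is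
  controlled by these Frobenius norms. Pulling back along it a subspace on which \<open>R11\<close> contracts,
  or taking all \<open>(a, d)\<close> with \<open>d\<close> in a subspace on which \<open>R22\<close> expands, gives test subspaces for
  \<open>R\<close>; the Courant-Fischer principle (lemmas \<open>singular_value_leI\<close> and \<open>singular_value_geI\<close>) turns
  them into the two families of singular value inequalities (lemmas \<open>singular_value_R_le_R11\<close> and
  \<open>singular_value_R22_le_R\<close>).

  The Courant-Fischer principle is derived from the spectral theorem for real symmetric matrices.
  Subspaces are described throughout as kernels of constraint matrices, so that every dimension
  count reduces to the fact that a matrix with more columns than rows has a nontrivial kernel.
\<close>

section \<open>Lengths of real vectors and kernels of wide matrices\<close>

lemma scalar_prod_self_nonneg: "0 \<le> (v :: real vec) \<bullet> v"
  by (auto simp: scalar_prod_def intro!: sum_nonneg)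

lemma scalar_prod_self_eq_0:
  assumes "v \<in> carrier_vec n" and "v \<bullet> v = (0 :: real)"
  shows "v = 0\<^sub>v n"
proof (rule eq_vecI)
  have "(\<Sum>i<n. v $ i * v $ i) = 0"
    using assms by (simp add: scalar_prod_def lessThan_atLeast0)
  then have "\<forall>i\<in>{..<n}. v $ i * v $ i = 0"
    by (subst (asm) sum_nonneg_eq_0_iff) auto
  then show "v $ i = 0\<^sub>v n $ i" if "i < dim_vec (0\<^sub>v n :: real vec)" for i
    using that by auto
qed (use assms in auto)

lemma scalar_prod_self_pos:
  assumes "v \<in> carrier_vec n" and "v \<noteq> 0\<^sub>v n"
  shows "0 < v \<bullet> (v :: real vec)"
  using assms scalar_prod_self_nonneg[of v] scalar_prod_self_eq_0[of v n] by fastforce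

lemma scalar_prod_self_add:
  assumes "u \<in> carrier_vec n" and "v \<in> carrier_vec n"
  shows "(u + v) \<bullet> (u + v) = u \<bullet> u + 2 * (u \<bullet> v) + v \<bullet> (v :: real vec)"
  using assms comm_scalar_prod[OF assms]
  by (simp add: add_scalar_prod_distrib[of _ n] scalar_prod_add_distrib[of _ n])

text \<open>
  The squared length of \<open>(u \<bullet> u) v - (u \<bullet> v) u\<close>, which is nonnegative, equals
  \<open>u \<bullet> u\<close> times the difference of the two sides.
\<close>
lemma Cauchy_Schwarz_vec:
  assumes u: "u \<in> carrier_vec n" and v: "v \<in> carrier_vec n"
  shows "(u \<bullet> v)\<^sup>2 \<le> (u \<bullet> u) * (v \<bullet> (v :: real vec))"
proof (cases "u \<bullet> u = 0")
  case True
  then have "u = 0\<^sub>v n" using scalar_prod_self_eq_0 u by blast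
  then show ?thesis using v by simp
next
  case False
  then have pos: "0 < u \<bullet> u" using scalar_prod_self_nonneg[of u] by linarith
  have "0 \<le> ((u \<bullet> u) \<cdot>\<^sub>v v + (- (u \<bullet> v)) \<cdot>\<^sub>v u) \<bullet> ((u \<bullet> u) \<cdot>\<^sub>v v + (- (u \<bullet> v)) \<cdot>\<^sub>v u)"
    by (rule scalar_prod_self_nonneg)
  also have "\<dots> = (u \<bullet> u) * ((u \<bullet> u) * (v \<bullet> v) - (u \<bullet> v)\<^sup>2)"
    using u v comm_scalar_prod[OF u v]
    by (subst scalar_prod_self_add[of _ n]) (auto simp: algebra_simps power2_eq_square)
  finally show ?thesis using pos by (simp add: zero_le_mult_iff)
qed

text \<open>
  This is the Cauchy-Schwarz inequality
  \<open>(\<surd>(a s) + \<surd>(b t))\<^sup>2 \<le> (a + b) (s + t)\<close> combined with the triangle inequality, arranged so that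
  no square root is taken. It bounds the distortion of lengths by a shear.
\<close>
lemma scalar_prod_self_add_le:
  assumes u: "u \<in> carrier_vec n" and v: "v \<in> carrier_vec n"
    and us: "u \<bullet> u \<le> a * s" and vt: "v \<bullet> v \<le> b * t"
    and nonneg: "0 \<le> a" "0 \<le> b" "0 \<le> s" "0 \<le> (t :: real)"
  shows "(u + v) \<bullet> (u + v) \<le> (a + b) * (s + t)"
proof -
  have "(2 * (u \<bullet> v))\<^sup>2 \<le> 4 * ((u \<bullet> u) * (v \<bullet> v))"
    using Cauchy_Schwarz_vec[OF u v] by (simp add: power2_eq_square)
  also have "\<dots> \<le> 4 * ((a * s) * (b * t))"
    using us vt nonneg by (intro mult_left_mono mult_mono scalar_prod_self_nonneg) auto
  also have "\<dots> = 4 * ((a * t) * (b * s))"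
    by (simp add: algebra_simps)
  also have "\<dots> \<le> (a * t + b * s)\<^sup>2"
    using zero_le_power2[of "a * t - b * s"] by (simp add: power2_eq_square algebra_simps)
  finally have "2 * (u \<bullet> v) \<le> a * t + b * s"
    by (rule power2_le_imp_le) (use nonneg in auto)
  then show ?thesis
    using us vt by (simp add: scalar_prod_self_add[OF u v] algebra_simps)
qed

text \<open>The squared Frobenius norm, summed row by row to match the rows of \<open>R11\<^sup>-\<^sup>1\<close> in \<open>\<rho>\<^sub>i\<^sub>j\<close>.\<close>

definition frob2 :: "real mat \<Rightarrow> real" where
  "frob2 M = (\<Sum>i<dim_row M. row M i \<bullet> row M i)"

lemma frob2_nonneg: "0 \<le> frob2 M"
  unfolding frob2_def by (intro sum_nonneg scalar_prod_self_nonneg)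

text \<open>
  The Frobenius norm dominates the operator norm: apply Cauchy-Schwarz to each row. This crude
  bound suffices here because the quantities \<open>\<rho>\<^sub>i\<^sub>j\<close> control entries and rows.
\<close>
lemma mult_mat_vec_norm_le:
  assumes M: "M \<in> carrier_mat m n" and x: "x \<in> carrier_vec n"
  shows "(M *\<^sub>v x) \<bullet> (M *\<^sub>v x) \<le> frob2 M * (x \<bullet> x)"
proof -
  have "(M *\<^sub>v x) \<bullet> (M *\<^sub>v x) = (\<Sum>i<m. (row M i \<bullet> x)\<^sup>2)"
    using M by (simp add: scalar_prod_def[of "M *\<^sub>v x"] lessThan_atLeast0 power2_eq_square)
  also have "\<dots> \<le> (\<Sum>i<m. (row M i \<bullet> row M i) * (x \<bullet> x))"
    using M x by (intro sum_mono Cauchy_Schwarz_vec[of _ n]) auto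
  also have "\<dots> = frob2 M * (x \<bullet> x)"
    using M by (simp add: frob2_def sum_distrib_right)
  finally show ?thesis .
qed

lemma frob2_entries:
  assumes "M \<in> carrier_mat m n"
  shows "frob2 M = (\<Sum>i<m. \<Sum>j<n. (M $$ (i, j))\<^sup>2)"
  using assms by (simp add: frob2_def scalar_prod_def lessThan_atLeast0 power2_eq_square)

lemma frob2_cols:
  assumes "M \<in> carrier_mat m n"
  shows "frob2 M = (\<Sum>j<n. col M j \<bullet> col M j)"
  unfolding frob2_entries[OF assms]
  using assms by (subst sum.swap) (simp add: scalar_prod_def lessThan_atLeast0 power2_eq_square)

lemma scalar_prod_mult_self:
  assumes M: "M \<in> carrier_mat m n" and x: "x \<in> carrier_vec n"
  shows "(M *\<^sub>v x) \<bullet> (M *\<^sub>v x) = x \<bullet> ((transpose_mat M * M) *\<^sub>v (x :: real vec))"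
proof -
  have "(M *\<^sub>v x) \<bullet> (M *\<^sub>v x) = (transpose_mat M *\<^sub>v (M *\<^sub>v x)) \<bullet> x"
    using transpose_vec_mult_scalar[OF M x, of "M *\<^sub>v x"] M x by simp
  also have "\<dots> = x \<bullet> (transpose_mat M *\<^sub>v (M *\<^sub>v x))"
    by (rule comm_scalar_prod[of _ n]) (use M x in auto)
  also have "transpose_mat M *\<^sub>v (M *\<^sub>v x) = (transpose_mat M * M) *\<^sub>v x"
    using M x by simp
  finally show ?thesis .
qed

text \<open>
  Padding with zero rows yields a square matrix of determinant zero.
\<close>
lemma kernel_wide_mat:
  fixes C :: "real mat"
  assumes C: "C \<in> carrier_mat r p" and "r < p"
  shows "\<exists>x\<in>carrier_vec p. x \<noteq> 0\<^sub>v p \<and> C *\<^sub>v x = 0\<^sub>v r"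
proof -
  define D where "D = mat p p (\<lambda>(i, j). if i < r then C $$ (i, j) else 0)"
  have D: "D \<in> carrier_mat p p" unfolding D_def by simp
  have "det D = (\<Sum>j<p. D $$ (r, j) * cofactor D r j)"
    by (rule laplace_expansion_row[OF D \<open>r < p\<close>])
  also have "\<dots> = 0" using \<open>r < p\<close> by (simp add: D_def)
  finally obtain x where x: "x \<in> carrier_vec p" "x \<noteq> 0\<^sub>v p" "D *\<^sub>v x = 0\<^sub>v p"
    using det_0_iff_vec_prod_zero[OF D] by auto
  have "C *\<^sub>v x = 0\<^sub>v r"
  proof (rule eq_vecI)
    fix i assume "i < dim_vec (0\<^sub>v r :: real vec)"
    then have i: "i < r" by simp
    then have "row C i = row D i" using C \<open>r < p\<close> by (intro eq_vecI) (auto simp: D_def)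
    then have "(C *\<^sub>v x) $ i = (D *\<^sub>v x) $ i" using i C D \<open>r < p\<close> by simp
    then show "(C *\<^sub>v x) $ i = 0\<^sub>v r $ i" using x i \<open>r < p\<close> by simp
  qed (use C in auto)
  then show ?thesis using x by blast
qed

text \<open>
  The dimension count behind the Courant-Fischer principle: subspaces of codimension \<open>r\<close> and \<open>s\<close>
  meet nontrivially if \<open>r + s < p\<close>, because stacking their constraints leaves a wide matrix.
\<close>
lemma kernel_inter:
  fixes C :: "real mat"
  assumes C: "C \<in> carrier_mat r p" and D: "D \<in> carrier_mat s p" and "r + s < p"
  obtains x where "x \<in> carrier_vec p" "0 < x \<bullet> x" "C *\<^sub>v x = 0\<^sub>v r" "D *\<^sub>v x = 0\<^sub>v s"
proof -
  have "C @\<^sub>r D \<in> carrier_mat (r + s) p" using C D by auto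
  from kernel_wide_mat[OF this \<open>r + s < p\<close>] obtain x
    where x: "x \<in> carrier_vec p" "x \<noteq> 0\<^sub>v p" "(C @\<^sub>r D) *\<^sub>v x = 0\<^sub>v (r + s)" by auto
  have "0\<^sub>v (r + s) = (0\<^sub>v r @\<^sub>v 0\<^sub>v s :: real vec)" by (intro eq_vecI) auto
  with x(3) have "(C *\<^sub>v x) @\<^sub>v (D *\<^sub>v x) = 0\<^sub>v r @\<^sub>v 0\<^sub>v s"
    unfolding mat_mult_append[OF C D x(1)] by simp
  then have "C *\<^sub>v x = 0\<^sub>v r" "D *\<^sub>v x = 0\<^sub>v s"
    using append_vec_eq[of "C *\<^sub>v x" r "0\<^sub>v r" "D *\<^sub>v x" "0\<^sub>v s"] C x(1) by auto
  then show ?thesis using that x scalar_prod_self_pos[OF x(1,2)] by blast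
qed

section \<open>Existence of QR decompositions\<close>

lemma unit_vec_orthogonal_to_cols:
  fixes Q :: "real mat"
  assumes Q: "Q \<in> carrier_mat n p" and "p < n"
  obtains q where "q \<in> carrier_vec n" "q \<bullet> q = 1" "transpose_mat Q *\<^sub>v q = 0\<^sub>v p"
proof -
  obtain x where x: "x \<in> carrier_vec n" "x \<noteq> 0\<^sub>v n" "transpose_mat Q *\<^sub>v x = 0\<^sub>v p"
    using kernel_wide_mat[of "transpose_mat Q" p n] assms by auto
  have pos: "0 < x \<bullet> x" by (rule scalar_prod_self_pos) fact+
  define q where "q = (1 / sqrt (x \<bullet> x)) \<cdot>\<^sub>v x"
  have "q \<bullet> q = 1" using x pos by (simp add: q_def)
  moreover have "transpose_mat Q *\<^sub>v q = 0\<^sub>v p"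
    unfolding q_def using mult_mat_vec[of "transpose_mat Q" p n x] x Q by auto
  ultimately show ?thesis using that[of q] x by (simp add: q_def)
qed

text \<open>
  Gram-Schmidt orthogonalisation by induction on the number of columns. If the new column depends
  on the previous ones, its residual vanishes and any unit vector orthogonal to the previous ones
  serves as the next column of \<open>Q\<close>, with diagonal entry 0; such a vector exists because \<open>p \<le> n\<close>.
\<close>
lemma qr_exists:
  fixes A :: "real mat"
  assumes "A \<in> carrier_mat n p" and "p \<le> n"
  shows "\<exists>Q R. Q \<in> carrier_mat n p \<and> transpose_mat Q * Q = 1\<^sub>m p \<and> R \<in> carrier_mat p p
    \<and> upper_triangular R \<and> (\<forall>i<p. 0 \<le> R $$ (i, i)) \<and> A = Q * R"
  using assms
proof (induction p arbitrary: A)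
  case 0
  show ?case
    by (rule exI[of _ "0\<^sub>m n 0"], rule exI[of _ "0\<^sub>m 0 0"]) (use 0 in auto)
next
  case (Suc p)
  define A' where "A' = mat n p (\<lambda>(i, j). A $$ (i, j))"
  define a where "a = col A p"
  have a: "a \<in> carrier_vec n" using Suc.prems unfolding a_def by auto
  obtain Q' R' where Q': "Q' \<in> carrier_mat n p" "transpose_mat Q' * Q' = 1\<^sub>m p"
    and R': "R' \<in> carrier_mat p p" "upper_triangular R'" "\<forall>i<p. 0 \<le> R' $$ (i, i)"
    and A': "A' = Q' * R'"
    using Suc.IH[of A'] Suc.prems by (auto simp: A'_def)
  define r where "r = transpose_mat Q' *\<^sub>v a"
  define w where "w = a - Q' *\<^sub>v r"
  have r: "r \<in> carrier_vec p" and w: "w \<in> carrier_vec n"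
    using Q' a by (auto simp: r_def w_def)
  have "transpose_mat Q' *\<^sub>v w = r - (transpose_mat Q' * Q') *\<^sub>v r"
    unfolding w_def r_def using Q'(1) a by (simp add: mult_minus_distrib_mat_vec[of _ p n])
  then have Q'w: "transpose_mat Q' *\<^sub>v w = 0\<^sub>v p" using Q'(2) r by simp
  obtain q \<rho> where q: "q \<in> carrier_vec n" "q \<bullet> q = 1" "transpose_mat Q' *\<^sub>v q = 0\<^sub>v p"
    and \<rho>: "0 \<le> \<rho>" "w = \<rho> \<cdot>\<^sub>v q"
  proof (cases "w = 0\<^sub>v n")
    case True
    obtain q where q: "q \<in> carrier_vec n" "q \<bullet> q = 1" "transpose_mat Q' *\<^sub>v q = 0\<^sub>v p"
      using unit_vec_orthogonal_to_cols[OF Q'(1)] Suc.prems by auto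
    moreover have "w = 0 \<cdot>\<^sub>v q" using q True by (intro eq_vecI) auto
    ultimately show ?thesis using that[of q 0] by auto
  next
    case False
    then have pos: "0 < w \<bullet> w" using scalar_prod_self_pos w by blast
    define q where "q = (1 / sqrt (w \<bullet> w)) \<cdot>\<^sub>v w"
    have "q \<bullet> q = 1" using w pos by (simp add: q_def)
    moreover have "transpose_mat Q' *\<^sub>v q = 0\<^sub>v p"
      unfolding q_def using mult_mat_vec[of "transpose_mat Q'" p n w] w Q' Q'w by auto
    moreover have "w = sqrt (w \<bullet> w) \<cdot>\<^sub>v q"
      using pos by (simp add: q_def smult_smult_assoc)
    ultimately show ?thesis using that[of q "sqrt (w \<bullet> w)"] w pos by (simp add: q_def)
  qed
  define Q where "Q = mat n (Suc p) (\<lambda>(i, j). if j < p then Q' $$ (i, j) else q $ i)"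
  define R where "R = mat (Suc p) (Suc p) (\<lambda>(i, j). if j < p then (if i < p then R' $$ (i, j) else 0)
    else if i < p then r $ i else \<rho>)"
  have Q: "Q \<in> carrier_mat n (Suc p)" and R: "R \<in> carrier_mat (Suc p) (Suc p)"
    by (auto simp: Q_def R_def)
  have colQ: "col Q j = (if j < p then col Q' j else q)" if "j < Suc p" for j
    using that Q' q by (intro eq_vecI) (auto simp: Q_def)
  have orth: "col Q' i \<bullet> q = 0" if "i < p" for i
  proof -
    have "(transpose_mat Q' *\<^sub>v q) $ i = 0" using q that by simp
    then show ?thesis using that Q' by simp
  qed
  have orth': "q \<bullet> col Q' i = 0" if "i < p" for i
    using orth[OF that] comm_scalar_prod[of q n "col Q' i"] q Q' that by auto
  have orthonormal: "col Q' i \<bullet> col Q' j = (if i = j then 1 else 0)" if "i < p" "j < p" for i j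
  proof -
    have "(transpose_mat Q' * Q') $$ (i, j) = (if i = j then 1 else 0)" using Q' that by simp
    then show ?thesis using that Q'(1) by simp
  qed
  have "transpose_mat Q * Q = 1\<^sub>m (Suc p)"
    using Q q by (intro eq_matI) (auto simp: colQ orth orth' orthonormal less_Suc_eq)
  moreover have "upper_triangular R"
    using R' by (auto simp: upper_triangular_def R_def)
  moreover have "\<forall>i<Suc p. 0 \<le> R $$ (i, i)" using R' \<rho> by (auto simp: R_def)
  moreover have "A = Q * R"
  proof (rule eq_matI)
    fix i j assume "i < dim_row (Q * R)" "j < dim_col (Q * R)"
    then have i: "i < n" and j: "j < Suc p" using Q R by auto
    have QR: "(Q * R) $$ (i, j) = (\<Sum>l<p. Q' $$ (i, l) * R $$ (l, j)) + q $ i * R $$ (p, j)"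
      using i j Q R by (simp add: scalar_prod_def flip: lessThan_atLeast0) (simp add: Q_def)
    show "A $$ (i, j) = (Q * R) $$ (i, j)"
    proof (cases "j < p")
      case True
      have "A $$ (i, j) = A' $$ (i, j)" using i True by (simp add: A'_def)
      also have "\<dots> = (\<Sum>l<p. Q' $$ (i, l) * R' $$ (l, j))"
        using i True Q' R' by (simp add: A' scalar_prod_def lessThan_atLeast0)
      finally show ?thesis unfolding QR using True by (simp add: R_def)
    next
      case False
      with j have jp: "j = p" by simp
      have "w $ i = \<rho> * q $ i" using \<rho> q i by simp
      then have "a $ i = (Q' *\<^sub>v r) $ i + q $ i * \<rho>" using i Q' r a by (simp add: w_def algebra_simps)
      also have "(Q' *\<^sub>v r) $ i = (\<Sum>l<p. Q' $$ (i, l) * r $ l)"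
        using i Q' r by (simp add: scalar_prod_def lessThan_atLeast0)
      finally show ?thesis unfolding QR using i jp Suc.prems by (simp add: R_def a_def)
    qed
  qed (use Suc.prems Q R in auto)
  ultimately show ?case using Q R by blast
qed

section \<open>The spectral theorem for real symmetric matrices\<close>

lemma orthogonal_mat_right:
  fixes U :: "real mat"
  assumes "U \<in> carrier_mat n n" and "transpose_mat U * U = 1\<^sub>m n"
  shows "U * transpose_mat U = 1\<^sub>m n"
  using mat_mult_left_right_inverse[of "transpose_mat U" n U] assms by auto

lemma orthogonal_mat_conj:
  fixes U :: "real mat"
  assumes U: "U \<in> carrier_mat n n" "transpose_mat U * U = 1\<^sub>m n"
    and V: "V \<in> carrier_mat n n" "transpose_mat V * V = 1\<^sub>m n"
    and A: "A \<in> carrier_mat n n"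
  shows "transpose_mat (U * V) * (U * V) = 1\<^sub>m n"
    and "transpose_mat (U * V) * A * (U * V) = transpose_mat V * (transpose_mat U * A * U) * V"
proof -
  have UT: "transpose_mat U \<in> carrier_mat n n" and VT: "transpose_mat V \<in> carrier_mat n n"
    using U V by auto
  have t: "transpose_mat (U * V) = transpose_mat V * transpose_mat U"
    by (rule transpose_mult[OF U(1) V(1)])
  have "transpose_mat (U * V) * (U * V) = transpose_mat V * ((transpose_mat U * U) * V)"
    unfolding t using U(1) V(1) UT VT
    by (simp add: assoc_mult_mat[of _ n n _ n _ n])
  then show "transpose_mat (U * V) * (U * V) = 1\<^sub>m n" using U V by simp
  show "transpose_mat (U * V) * A * (U * V) = transpose_mat V * (transpose_mat U * A * U) * V"
    unfolding t using U(1) V(1) UT VT A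
    by (simp add: assoc_mult_mat[of _ n n _ n _ n])
qed

text \<open>
  A QR decomposition of the square matrix all of whose columns are \<open>v\<close> completes the direction of
  \<open>v\<close> to an orthonormal basis, since the first column of \<open>R\<close> has a single nonzero entry.
\<close>
lemma orthogonal_mat_first_col:
  fixes v :: "real vec"
  assumes v: "v \<in> carrier_vec (Suc m)" "v \<noteq> 0\<^sub>v (Suc m)"
  obtains W c where "W \<in> carrier_mat (Suc m) (Suc m)" "transpose_mat W * W = 1\<^sub>m (Suc m)"
    "v = c \<cdot>\<^sub>v col W 0" "c \<noteq> 0"
proof -
  define B where "B = mat (Suc m) (Suc m) (\<lambda>(i, j). v $ i)"
  obtain W R where W: "W \<in> carrier_mat (Suc m) (Suc m)" "transpose_mat W * W = 1\<^sub>m (Suc m)"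
    and R: "R \<in> carrier_mat (Suc m) (Suc m)" "upper_triangular R" and B: "B = W * R"
    using qr_exists[of B "Suc m" "Suc m"] by (auto simp: B_def)
  have "v = R $$ (0, 0) \<cdot>\<^sub>v col W 0"
  proof (rule eq_vecI)
    fix i assume "i < dim_vec (R $$ (0, 0) \<cdot>\<^sub>v col W 0)"
    then have i: "i < Suc m" using W by simp
    have "v $ i = (W * R) $$ (i, 0)" using i unfolding B[symmetric] by (simp add: B_def)
    also have "\<dots> = (\<Sum>l<Suc m. W $$ (i, l) * R $$ (l, 0))"
      using i W R by (simp add: scalar_prod_def lessThan_atLeast0)
    also have "\<dots> = (\<Sum>l<Suc m. if l = 0 then W $$ (i, 0) * R $$ (0, 0) else 0)"
      using R by (intro sum.cong) (auto simp: upper_triangular_def)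
    also have "\<dots> = W $$ (i, 0) * R $$ (0, 0)" by simp
    finally show "v $ i = (R $$ (0, 0) \<cdot>\<^sub>v col W 0) $ i" using i W by simp
  qed (use v W in auto)
  moreover from this have "R $$ (0, 0) \<noteq> 0" using v W by auto
  ultimately show ?thesis using that W by blast
qed

text \<open>
  The eigenvalues are peeled off in the order prescribed by the list \<open>es\<close>, so that a sorted list of
  eigenvalues directly gives a sorted diagonal. An eigenvector for the head of the list is completed
  to an orthonormal basis; by symmetry the conjugated matrix is block diagonal, and the
  characteristic polynomial of the remaining block is the product over the tail.
\<close>
lemma spectral_symmetric:
  fixes A :: "real mat"
  assumes "A \<in> carrier_mat n n" and "transpose_mat A = A"
    and "char_poly A = (\<Prod>e\<leftarrow>es. [:- e, 1:])"
  shows "length es = n \<and> (\<exists>U. U \<in> carrier_mat n n \<and> transpose_mat U * U = 1\<^sub>m n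
    \<and> transpose_mat U * A * U = mat_diag n (\<lambda>i. es ! i))"
  using assms
proof (induction es arbitrary: n A)
  case Nil
  then have "n = 0" using degree_monic_char_poly[OF Nil(1)] by simp
  then show ?case
    using Nil by (intro conjI exI[of _ "1\<^sub>m 0"]) (auto intro!: eq_matI simp: mat_diag_def)
next
  case (Cons e es)
  have "degree (char_poly A) = Suc (length es)"
    using Cons.prems(3) degree_linear_factors[of uminus "e # es"] by simp
  then obtain m where n: "n = Suc m" and m: "m = length es"
    using degree_monic_char_poly[OF Cons.prems(1)] by auto
  have "poly (char_poly A) e = 0" unfolding Cons.prems(3) by simp
  then have "eigenvalue A e" using eigenvalue_root_char_poly[OF Cons.prems(1)] by simp
  then obtain v where v: "v \<in> carrier_vec n" "v \<noteq> 0\<^sub>v n" "A *\<^sub>v v = e \<cdot>\<^sub>v v"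
    using Cons.prems(1) unfolding eigenvalue_def eigenvector_def by auto
  obtain W c where W: "W \<in> carrier_mat n n" "transpose_mat W * W = 1\<^sub>m n"
    and vW: "v = c \<cdot>\<^sub>v col W 0" "c \<noteq> 0"
    using orthogonal_mat_first_col[of v m] v n by metis
  define w where "w = col W 0"
  have w: "w \<in> carrier_vec n" using W n unfolding w_def by (intro carrier_vecI) auto
  have "w = (1 / c) \<cdot>\<^sub>v v" using vW by (simp add: w_def smult_smult_assoc)
  then have Aw: "A *\<^sub>v w = e \<cdot>\<^sub>v w"
    using v Cons.prems(1) mult_mat_vec[of A n n v "1 / c"] by (simp add: smult_smult_assoc mult.commute)
  define B where "B = transpose_mat W * A * W"
  have B: "B \<in> carrier_mat n n" using W Cons.prems unfolding B_def by auto
  have sym: "transpose_mat B = B"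
    unfolding B_def using W(1) Cons.prems(1,2)
    by (simp add: transpose_mult[of _ n n _ n] assoc_mult_mat[of _ n n _ n _ n])
  have col0: "B $$ (i, 0) = (if i = 0 then e else 0)" if i: "i < n" for i
  proof -
    have "B = transpose_mat W * (A * W)"
      unfolding B_def using W Cons.prems by (intro assoc_mult_mat) auto
    then have "B $$ (i, 0) = col W i \<bullet> col (A * W) 0"
      using i n W Cons.prems(1) by simp
    also have "col (A * W) 0 = A *\<^sub>v w"
      unfolding w_def using W Cons.prems n by (intro col_mult2) auto
    also have "col W i \<bullet> \<dots> = e * (transpose_mat W * W) $$ (i, 0)"
      unfolding Aw using W(1) w i n by (simp add: w_def)
    also have "\<dots> = (if i = 0 then e else 0)" unfolding W(2) using i n by simp
    finally show ?thesis .
  qed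
  have row0: "B $$ (0, i) = (if i = 0 then e else 0)" if i: "i < n" for i
  proof -
    have "B $$ (0, i) = transpose_mat B $$ (i, 0)" using B i n by simp
    then show ?thesis unfolding sym using col0[OF i] by simp
  qed
  define B' where "B' = mat m m (\<lambda>(i, j). B $$ (Suc i, Suc j))"
  define E where "E = mat 1 1 (\<lambda>_. e)"
  have B': "B' \<in> carrier_mat m m" and E: "E \<in> carrier_mat 1 1" by (auto simp: B'_def E_def)
  have blockB: "B = four_block_mat E (0\<^sub>m 1 m) (0\<^sub>m m 1) B'"
    using B n by (intro eq_matI) (auto simp: B'_def E_def col0 row0)
  have symB': "transpose_mat B' = B'"
  proof (rule eq_matI)
    fix i j assume "i < dim_row B'" "j < dim_col B'"
    then have ij: "i < m" "j < m" using B' by auto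
    then have "transpose_mat B $$ (Suc i, Suc j) = B $$ (Suc j, Suc i)" using B n by simp
    then show "transpose_mat B' $$ (i, j) = B' $$ (i, j)"
      unfolding sym using ij by (simp add: B'_def)
  qed (use B' in auto)
  have WW: "W * transpose_mat W = 1\<^sub>m n" by (rule orthogonal_mat_right) fact+
  have "similar_mat B A"
    by (rule similar_matI[of _ _ "transpose_mat W" W n]) (use B W WW Cons.prems B_def in auto)
  then have "char_poly B = char_poly A" by (rule char_poly_similar)
  moreover have "char_poly B = char_poly E * char_poly B'"
    unfolding blockB by (rule char_poly_four_block_zeros_col[OF E _ B']) simp
  moreover have "char_poly E = [:- e, 1:]"
    using char_poly_upper_triangular[OF E] by (simp add: E_def diag_mat_def upper_triangular_def)
  ultimately have "char_poly B' = (\<Prod>e\<leftarrow>es. [:- e, 1:])"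
    using Cons.prems(3) by (simp del: mult_pCons_left)
  from Cons.IH[OF B' symB' this] obtain V where V: "V \<in> carrier_mat m m" "transpose_mat V * V = 1\<^sub>m m"
    and D: "transpose_mat V * B' * V = mat_diag m (\<lambda>i. es ! i)" by blast
  define F where "F = four_block_mat (1\<^sub>m 1) (0\<^sub>m 1 m) (0\<^sub>m m 1) V"
  have F: "F \<in> carrier_mat n n" using V n unfolding F_def by auto
  have FT: "transpose_mat F = four_block_mat (1\<^sub>m 1) (0\<^sub>m 1 m) (0\<^sub>m m 1) (transpose_mat V)"
    unfolding F_def using V
    by (subst transpose_four_block_mat[of _ 1 1 _ m _ m]) (auto simp: transpose_one zero_transpose_mat)
  have "transpose_mat F * F = four_block_mat (1\<^sub>m 1) (0\<^sub>m 1 m) (0\<^sub>m m 1) (transpose_mat V * V)"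
    unfolding FT unfolding F_def using V
    by (subst mult_four_block_mat[of _ 1 1 _ m _ m _ _ 1 _ m]) auto
  then have FF: "transpose_mat F * F = 1\<^sub>m n" using V n by simp
  have "transpose_mat F * B = four_block_mat E (0\<^sub>m 1 m) (0\<^sub>m m 1) (transpose_mat V * B')"
    unfolding FT blockB using V E B'
    by (subst mult_four_block_mat[of _ 1 1 _ m _ m _ _ 1 _ m]) auto
  then have "transpose_mat F * B * F
      = four_block_mat E (0\<^sub>m 1 m) (0\<^sub>m m 1) (transpose_mat V * B' * V)"
    unfolding F_def using V E B'
    by (simp, subst mult_four_block_mat[of _ 1 1 _ m _ m _ _ 1 _ m]) auto
  also have "\<dots> = mat_diag n (\<lambda>i. (e # es) ! i)"
    unfolding D using n by (intro eq_matI) (auto simp: mat_diag_def E_def)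
  finally have FBF: "transpose_mat F * B * F = mat_diag n (\<lambda>i. (e # es) ! i)" .
  note * = orthogonal_mat_conj[OF W F FF Cons.prems(1)]
  show ?case
    using * FBF W F m n unfolding B_def by (intro conjI exI[of _ "W * F"]) auto
qed

text \<open>
  For an eigenvector \<open>v\<close>, symmetry of \<open>A\<close> makes the Hermitian form \<open>v\<^sup>* A v = a (v\<^sup>* v)\<close> equal to
  its own conjugate, and \<open>v\<^sup>* v\<close> is a positive real number.
\<close>
lemma symmetric_eigenvalue_real:
  fixes A :: "real mat"
  assumes A: "A \<in> carrier_mat n n" and sym: "transpose_mat A = A"
    and ev: "eigenvalue (map_mat complex_of_real A) a"
  shows "a \<in> \<real>"
proof -
  let ?A = "map_mat complex_of_real A"
  obtain v where v: "v \<in> carrier_vec n" "v \<noteq> 0\<^sub>v n" "?A *\<^sub>v v = a \<cdot>\<^sub>v v"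
    using ev A unfolding eigenvalue_def eigenvector_def by auto
  have Av: "(\<Sum>j<n. of_real (A $$ (i, j)) * v $ j) = a * v $ i" if i: "i < n" for i
  proof -
    have "(?A *\<^sub>v v) $ i = (\<Sum>j<n. of_real (A $$ (i, j)) * v $ j)"
      using i A v(1) by (simp add: scalar_prod_def lessThan_atLeast0)
    then show ?thesis unfolding v(3) using v(1) i by simp
  qed
  have symA: "A $$ (i, j) = A $$ (j, i)" if "i < n" "j < n" for i j
    using that A arg_cong[OF sym, of "\<lambda>M. M $$ (i, j)"] by simp
  define s where "s = (\<Sum>i<n. cnj (v $ i) * v $ i)"
  have s_real: "s = of_real (\<Sum>i<n. (cmod (v $ i))\<^sup>2)"
    unfolding s_def of_real_sum
    by (intro sum.cong refl) (metis complex_norm_square mult.commute of_real_power)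
  obtain k where k: "k < n" "v $ k \<noteq> 0" using v(1,2) by (auto simp: vec_eq_iff)
  have "0 < (cmod (v $ k))\<^sup>2" using k by simp
  also have "\<dots> \<le> (\<Sum>i<n. (cmod (v $ i))\<^sup>2)"
    by (rule member_le_sum) (use k in auto)
  finally have s0: "s \<noteq> 0" unfolding s_real of_real_eq_0_iff by linarith
  have 1: "a * s = (\<Sum>i<n. \<Sum>j<n. cnj (v $ i) * of_real (A $$ (i, j)) * v $ j)"
  proof -
    have "a * s = (\<Sum>i<n. cnj (v $ i) * (a * v $ i))"
      by (simp add: s_def sum_distrib_left mult_ac)
    also have "\<dots> = (\<Sum>i<n. cnj (v $ i) * (\<Sum>j<n. of_real (A $$ (i, j)) * v $ j))"
      by (simp add: Av)
    finally show ?thesis by (simp add: sum_distrib_left mult_ac)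
  qed
  have "cnj (a * s) = (\<Sum>i<n. \<Sum>j<n. v $ i * of_real (A $$ (i, j)) * cnj (v $ j))"
    unfolding 1 by simp
  also have "\<dots> = (\<Sum>i<n. \<Sum>j<n. v $ j * of_real (A $$ (j, i)) * cnj (v $ i))"
    by (rule sum.swap)
  also have "\<dots> = a * s" unfolding 1
    by (intro sum.cong refl) (simp add: symA mult_ac)
  finally have "cnj a * s = a * s" by (simp add: s_real)
  then show ?thesis using s0 by (simp add: Reals_cnj_iff)
qed

text \<open>
  Over the complex numbers the polynomial splits, and all of its roots are real by the preceding
  lemma; the factorisation then descends along the injective map of polynomial rings.
\<close>
lemma char_poly_symmetric_splits:
  fixes A :: "real mat"
  assumes A: "A \<in> carrier_mat n n" and sym: "transpose_mat A = A"
  shows "\<exists>es. char_poly A = (\<Prod>e\<leftarrow>es. [:- e, 1:])"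
proof -
  interpret poly: map_poly_inj_comm_ring_hom complex_of_real ..
  let ?A = "map_mat complex_of_real A"
  have cA: "?A \<in> carrier_mat n n" using A by simp
  obtain as where as: "char_poly ?A = (\<Prod>a\<leftarrow>as. [:- a, 1:])"
    using char_poly_factorized[OF cA] by blast
  have "a \<in> \<real>" if "a \<in> set as" for a
  proof -
    have "poly (char_poly ?A) a = 0"
      unfolding as poly_prod_list prod_list_zero_iff using that by auto
    then show ?thesis
      using symmetric_eigenvalue_real[OF A sym] eigenvalue_root_char_poly[OF cA] by simp
  qed
  then have "map (\<lambda>a. [:- a, 1:]) as
      = map (map_poly complex_of_real) (map (\<lambda>e. [:- e, 1:]) (map Re as))"
    by (auto simp: map_poly_pCons)
  then have "map_poly complex_of_real (char_poly A)
      = map_poly complex_of_real (\<Prod>e\<leftarrow>map Re as. [:- e, 1:])"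
    using as unfolding of_real_hom.char_poly_hom[OF A] poly.hom_prod_list by metis
  then show ?thesis using poly.injectivity by blast
qed

section \<open>The Courant-Fischer principle for singular values\<close>

lemma proots_linear_factors: "proots (\<Prod>e\<leftarrow>es. [:- e, 1:]) = mset (es :: real list)"
proof (induction es)
  case (Cons e es)
  have "(\<Prod>e\<leftarrow>es. [:- e, 1:]) \<noteq> 0" by (auto simp: prod_list_zero_iff)
  then show ?case using Cons by (simp add: proots_mult del: mult_pCons_left)
qed simp

text \<open>
  Connects the definition of singular values through roots of the characteristic polynomial of
  \<open>M\<^sup>T M\<close> with an orthonormal eigenbasis listed in non-increasing order of the eigenvalues. The
  eigenvalues are nonnegative, being squared lengths of images under \<open>M\<close>.
\<close>
lemma singular_values_via_eigenbasis:
  assumes M: "M \<in> carrier_mat m p" and "p \<le> m"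
  obtains U es where "U \<in> carrier_mat p p" "transpose_mat U * U = 1\<^sub>m p"
    "transpose_mat U * (transpose_mat M * M) * U = mat_diag p (\<lambda>i. es ! i)"
    "length es = p" "sorted_wrt (\<ge>) es" "\<And>e. e \<in> set es \<Longrightarrow> 0 \<le> e"
    "\<And>i. 1 \<le> i \<Longrightarrow> i \<le> p \<Longrightarrow> singular_value i M = sqrt (es ! (i - 1))"
proof -
  let ?G = "transpose_mat M * M"
  have G: "?G \<in> carrier_mat p p" using M by auto
  have symG: "transpose_mat ?G = ?G"
    using M by (simp add: transpose_mult[of _ p m])
  obtain fs where fs: "char_poly ?G = (\<Prod>e\<leftarrow>fs. [:- e, 1:])"
    using char_poly_symmetric_splits[OF G symG] by blast
  define es where "es = rev (sorted_list_of_multiset (proots (char_poly ?G)))"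
  have mset: "mset es = mset fs"
    by (simp add: es_def fs proots_linear_factors)
  have "char_poly ?G = (\<Prod>e\<leftarrow>es. [:- e, 1:])"
    unfolding fs prod_mset_prod_list[symmetric] mset_map mset ..
  from spectral_symmetric[OF G symG this] obtain U where len: "length es = p"
    and U: "U \<in> carrier_mat p p" "transpose_mat U * U = 1\<^sub>m p"
    and D: "transpose_mat U * ?G * U = mat_diag p (\<lambda>i. es ! i)" by blast
  have nonneg: "0 \<le> es ! i" if i: "i < p" for i
  proof -
    have "es ! i = (transpose_mat U * ?G * U) $$ (i, i)" unfolding D using i by (simp add: mat_diag_def)
    also have "transpose_mat U * ?G * U = transpose_mat (M * U) * (M * U)"
      using M U by (simp add: transpose_mult[of _ m p] assoc_mult_mat[of _ p p _ m _ p]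
        assoc_mult_mat[of _ p m _ p _ p] assoc_mult_mat[of _ p p _ p _ p])
    also have "\<dots> $$ (i, i) = col (M * U) i \<bullet> col (M * U) i" using i M U by simp
    finally show ?thesis using scalar_prod_self_nonneg by simp
  qed
  have "sorted (map sqrt (rev es))" unfolding es_def rev_rev_ident
    by (rule sorted_map_mono) (auto intro!: mono_onI)
  moreover have "mset (map sqrt (rev es)) = image_mset sqrt (proots (char_poly ?G))"
    by (simp add: es_def)
  ultimately have "sorted_list_of_multiset (image_mset sqrt (proots (char_poly ?G))) = map sqrt (rev es)"
    by (metis sorted_list_of_multiset_mset sorted_sort_id)
  then have "singular_values M = map sqrt es"
    using M \<open>p \<le> m\<close> len by (simp add: singular_values_def rev_map)
  then have "singular_value i M = sqrt (es ! (i - 1))" if "1 \<le> i" "i \<le> p" for i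
    using that len by (simp add: singular_value_def)
  moreover have "sorted_wrt (\<ge>) es" by (simp add: es_def sorted_wrt_rev)
  moreover have "0 \<le> e" if "e \<in> set es" for e using that nonneg len by (auto simp: in_set_conv_nth)
  ultimately show ?thesis using that[OF U D len] by blast
qed

lemma mat_diag_mult_vec:
  assumes "y \<in> carrier_vec n"
  shows "mat_diag n f *\<^sub>v y = vec n (\<lambda>i. f i * y $ i)"
proof (rule eq_vecI)
  fix i assume "i < dim_vec (vec n (\<lambda>i. f i * y $ i))"
  then have i: "i < n" by simp
  then have "(mat_diag n f *\<^sub>v y) $ i = (\<Sum>j<n. (if i = j then f j else 0) * y $ j)"
    using assms by (simp add: mat_diag_def scalar_prod_def lessThan_atLeast0)
  also have "\<dots> = (\<Sum>j<n. if i = j then f j * y $ j else 0)"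
    by (intro sum.cong) auto
  also have "\<dots> = f i * y $ i" using i by simp
  finally show "(mat_diag n f *\<^sub>v y) $ i = vec n (\<lambda>i. f i * y $ i) $ i" using i by simp
qed (use assms in \<open>auto simp: mat_diag_def\<close>)

text \<open>
  Expansion of both quadratic forms in the coordinates \<open>U\<^sup>T x\<close> of \<open>x\<close> with respect to the
  eigenbasis.
\<close>
lemma quadratic_forms_in_eigenbasis:
  fixes U :: "real mat"
  assumes M: "M \<in> carrier_mat m p" and U: "U \<in> carrier_mat p p" "transpose_mat U * U = 1\<^sub>m p"
    and D: "transpose_mat U * (transpose_mat M * M) * U = mat_diag p f"
    and x: "x \<in> carrier_vec p"
  shows "(M *\<^sub>v x) \<bullet> (M *\<^sub>v x) = (\<Sum>l<p. f l * (col U l \<bullet> x)\<^sup>2)"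
    and "x \<bullet> x = (\<Sum>l<p. (col U l \<bullet> x)\<^sup>2)"
proof -
  define y where "y = transpose_mat U *\<^sub>v x"
  have y: "y \<in> carrier_vec p" using U x by (simp add: y_def)
  have yl: "y $ l = col U l \<bullet> x" if "l < p" for l using that U by (simp add: y_def)
  have UT: "transpose_mat U \<in> carrier_mat p p" using U by simp
  have "U *\<^sub>v y = (U * transpose_mat U) *\<^sub>v x" using U(1) UT x by (simp add: y_def)
  then have Uy: "U *\<^sub>v y = x" using orthogonal_mat_right[OF U] x by simp
  have "x \<bullet> x = y \<bullet> ((transpose_mat U * U) *\<^sub>v y)"
    using scalar_prod_mult_self[OF U(1) y] unfolding Uy .
  also have "\<dots> = (\<Sum>l<p. (col U l \<bullet> x)\<^sup>2)"
    using y by (simp add: U(2) scalar_prod_def[of y] lessThan_atLeast0 yl power2_eq_square)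
  finally show "x \<bullet> x = (\<Sum>l<p. (col U l \<bullet> x)\<^sup>2)" .
  have MU: "M * U \<in> carrier_mat m p" using M U by simp
  have "transpose_mat (M * U) * (M * U) = transpose_mat U * (transpose_mat M * M) * U"
    using M U(1) by (simp add: transpose_mult[of _ m p] assoc_mult_mat[of _ p p _ m _ p]
        assoc_mult_mat[of _ p m _ p _ p] assoc_mult_mat[of _ p p _ p _ p])
  then have D': "transpose_mat (M * U) * (M * U) = mat_diag p f" unfolding D .
  have "M *\<^sub>v x = (M * U) *\<^sub>v y" unfolding Uy[symmetric] using M U(1) y by simp
  then have "(M *\<^sub>v x) \<bullet> (M *\<^sub>v x) = y \<bullet> (mat_diag p f *\<^sub>v y)"
    using scalar_prod_mult_self[OF MU y] D' by simp
  also have "\<dots> = (\<Sum>l<p. f l * (col U l \<bullet> x)\<^sup>2)"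
    using y by (simp add: mat_diag_mult_vec[OF y] scalar_prod_def[of y] lessThan_atLeast0 yl
        power2_eq_square mult_ac)
  finally show "(M *\<^sub>v x) \<bullet> (M *\<^sub>v x) = (\<Sum>l<p. f l * (col U l \<bullet> x)\<^sup>2)" .
qed

lemma singular_value_nonneg:
  assumes M: "M \<in> carrier_mat m p" and "p \<le> m" and i: "1 \<le> i" "i \<le> p"
  shows "0 \<le> singular_value i M"
  by (rule singular_values_via_eigenbasis[OF M \<open>p \<le> m\<close>]) (use i in auto)

text \<open>
  The optimal subspaces are spanned by eigenvectors: on the orthogonal complement of the first
  \<open>i - 1\<close> of them \<open>M\<close> stretches by at most \<open>\<sigma>\<^sub>i\<close>, and on the orthogonal complement of the last
  \<open>p - i\<close> of them by at least \<open>\<sigma>\<^sub>i\<close>. The constraint matrix collects the eigenvectors in question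
  as rows.
\<close>
lemma singular_value_subspaces:
  assumes M: "M \<in> carrier_mat m p" and "p \<le> m" and i: "1 \<le> i" "i \<le> p"
  shows "\<exists>C\<in>carrier_mat (i - 1) p. \<forall>x\<in>carrier_vec p. C *\<^sub>v x = 0\<^sub>v (i - 1)
      \<longrightarrow> (M *\<^sub>v x) \<bullet> (M *\<^sub>v x) \<le> (singular_value i M)\<^sup>2 * (x \<bullet> x)"
    and "\<exists>C\<in>carrier_mat (p - i) p. \<forall>x\<in>carrier_vec p. C *\<^sub>v x = 0\<^sub>v (p - i)
      \<longrightarrow> (singular_value i M)\<^sup>2 * (x \<bullet> x) \<le> (M *\<^sub>v x) \<bullet> (M *\<^sub>v x)"
proof -
  obtain U es where U: "U \<in> carrier_mat p p" "transpose_mat U * U = 1\<^sub>m p"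
    and D: "transpose_mat U * (transpose_mat M * M) * U = mat_diag p (\<lambda>i. es ! i)"
    and es: "length es = p" "sorted_wrt (\<ge>) es" "\<And>e. e \<in> set es \<Longrightarrow> 0 \<le> e"
    and \<sigma>: "singular_value i M = sqrt (es ! (i - 1))"
    using singular_values_via_eigenbasis[OF M \<open>p \<le> m\<close>] i by metis
  note expand = quadratic_forms_in_eigenbasis[OF M U D]
  have \<sigma>2: "(singular_value i M)\<^sup>2 = es ! (i - 1)"
    unfolding \<sigma> using es i by simp
  have mono: "es ! b \<le> es ! a" if "a \<le> b" "b < p" for a b
    using that es sorted_wrt_nth_less[OF es(2), of a b] by (cases "a = b") auto
  \<comment> \<open>the rows of \<open>C r s\<close> are the \<open>s\<close> eigenvectors following the first \<open>r\<close>\<close>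
  define C where "C r s = mat s p (\<lambda>(l, j). U $$ (j, r + l))" for r s
  have rowC: "row (C r s) l = col U (r + l)" if "l < s" "r + s \<le> p" for r s l
    using that U(1) by (intro eq_vecI) (auto simp: C_def)
  have C0: "col U (r + l) \<bullet> x = 0" if "C r s *\<^sub>v x = 0\<^sub>v s" "l < s" "r + s \<le> p" for r s l x
  proof -
    have "dim_row (C r s) = s" by (simp add: C_def)
    then have "(C r s *\<^sub>v x) $ l = row (C r s) l \<bullet> x" using that(2) by simp
    then show ?thesis unfolding rowC[OF that(2,3)] that(1) using that(2) by simp
  qed
  show "\<exists>C\<in>carrier_mat (i - 1) p. \<forall>x\<in>carrier_vec p. C *\<^sub>v x = 0\<^sub>v (i - 1)
      \<longrightarrow> (M *\<^sub>v x) \<bullet> (M *\<^sub>v x) \<le> (singular_value i M)\<^sup>2 * (x \<bullet> x)"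
  proof (intro bexI ballI impI)
    fix x :: "real vec" assume x: "x \<in> carrier_vec p" and Cx: "C 0 (i - 1) *\<^sub>v x = 0\<^sub>v (i - 1)"
    have "es ! l * (col U l \<bullet> x)\<^sup>2 \<le> es ! (i - 1) * (col U l \<bullet> x)\<^sup>2" if "l < p" for l
    proof (cases "l < i - 1")
      case True
      then show ?thesis using C0[OF Cx True] i by simp
    next
      case False
      then show ?thesis using mono[of "i - 1" l] that by (simp add: mult_right_mono)
    qed
    then show "(M *\<^sub>v x) \<bullet> (M *\<^sub>v x) \<le> (singular_value i M)\<^sup>2 * (x \<bullet> x)"
      unfolding expand[OF x] \<sigma>2 sum_distrib_left by (intro sum_mono) auto
  qed (simp add: C_def)
  show "\<exists>C\<in>carrier_mat (p - i) p. \<forall>x\<in>carrier_vec p. C *\<^sub>v x = 0\<^sub>v (p - i)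
      \<longrightarrow> (singular_value i M)\<^sup>2 * (x \<bullet> x) \<le> (M *\<^sub>v x) \<bullet> (M *\<^sub>v x)"
  proof (intro bexI ballI impI)
    fix x :: "real vec" assume x: "x \<in> carrier_vec p" and Cx: "C i (p - i) *\<^sub>v x = 0\<^sub>v (p - i)"
    have "es ! (i - 1) * (col U l \<bullet> x)\<^sup>2 \<le> es ! l * (col U l \<bullet> x)\<^sup>2" if "l < p" for l
    proof (cases "i \<le> l")
      case True
      then show ?thesis using C0[OF Cx, of "l - i"] i that by simp
    next
      case False
      then show ?thesis using mono[of l "i - 1"] i by (simp add: mult_right_mono)
    qed
    then show "(singular_value i M)\<^sup>2 * (x \<bullet> x) \<le> (M *\<^sub>v x) \<bullet> (M *\<^sub>v x)"
      unfolding expand[OF x] \<sigma>2 sum_distrib_left by (intro sum_mono) auto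
  qed (simp add: C_def)
qed

text \<open>
  Any test subspace of codimension at most \<open>i - 1\<close> meets the optimal \<open>i\<close>-dimensional expanding subspace in a
  nonzero vector, on which the two estimates can be compared.
\<close>
lemma singular_value_leI:
  assumes M: "M \<in> carrier_mat m p" and "p \<le> m" and i: "1 \<le> i" "i \<le> p"
    and C: "C \<in> carrier_mat (i - 1) p" and "0 \<le> s"
    and bound: "\<And>x. x \<in> carrier_vec p \<Longrightarrow> C *\<^sub>v x = 0\<^sub>v (i - 1)
      \<Longrightarrow> (M *\<^sub>v x) \<bullet> (M *\<^sub>v x) \<le> s\<^sup>2 * (x \<bullet> x)"
  shows "singular_value i M \<le> s"
proof -
  obtain D where D: "D \<in> carrier_mat (p - i) p" "\<And>x. x \<in> carrier_vec p \<Longrightarrow> D *\<^sub>v x = 0\<^sub>v (p - i)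
      \<Longrightarrow> (singular_value i M)\<^sup>2 * (x \<bullet> x) \<le> (M *\<^sub>v x) \<bullet> (M *\<^sub>v x)"
    using singular_value_subspaces(2)[OF M \<open>p \<le> m\<close> i] by blast
  obtain x where x: "x \<in> carrier_vec p" "0 < x \<bullet> x" "C *\<^sub>v x = 0\<^sub>v (i - 1)" "D *\<^sub>v x = 0\<^sub>v (p - i)"
    using kernel_inter[OF C D(1)] i by auto
  have "(singular_value i M)\<^sup>2 * (x \<bullet> x) \<le> s\<^sup>2 * (x \<bullet> x)"
    using bound[OF x(1,3)] D(2)[OF x(1,4)] by linarith
  then show ?thesis using x(2) \<open>0 \<le> s\<close> by (auto intro: power2_le_imp_le)
qed

text \<open>
  Dual to the preceding lemma: a test subspace of dimension at least \<open>i\<close> meets the optimal contracting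
  subspace of codimension \<open>i - 1\<close>.
\<close>
lemma singular_value_geI:
  assumes M: "M \<in> carrier_mat m p" and "p \<le> m" and i: "1 \<le> i" "i \<le> p"
    and C: "C \<in> carrier_mat (p - i) p"
    and bound: "\<And>x. x \<in> carrier_vec p \<Longrightarrow> C *\<^sub>v x = 0\<^sub>v (p - i)
      \<Longrightarrow> s\<^sup>2 * (x \<bullet> x) \<le> (M *\<^sub>v x) \<bullet> (M *\<^sub>v x)"
  shows "s \<le> singular_value i M"
proof -
  obtain D where D: "D \<in> carrier_mat (i - 1) p" "\<And>x. x \<in> carrier_vec p \<Longrightarrow> D *\<^sub>v x = 0\<^sub>v (i - 1)
      \<Longrightarrow> (M *\<^sub>v x) \<bullet> (M *\<^sub>v x) \<le> (singular_value i M)\<^sup>2 * (x \<bullet> x)"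
    using singular_value_subspaces(1)[OF M \<open>p \<le> m\<close> i] by blast
  obtain x where x: "x \<in> carrier_vec p" "0 < x \<bullet> x" "C *\<^sub>v x = 0\<^sub>v (p - i)" "D *\<^sub>v x = 0\<^sub>v (i - 1)"
    using kernel_inter[OF C D(1)] i by auto
  have "s\<^sup>2 * (x \<bullet> x) \<le> (singular_value i M)\<^sup>2 * (x \<bullet> x)"
    using bound[OF x(1,3)] D(2)[OF x(1,4)] by linarith
  then show ?thesis
    using x(2) singular_value_nonneg[OF M \<open>p \<le> m\<close> i] by (auto intro: power2_le_imp_le)
qed

section \<open>Singular values of block triangular matrices\<close>

context
  fixes R11 R12 R22 N :: "real mat" and k q :: nat
  assumes R11: "R11 \<in> carrier_mat k k" and R12: "R12 \<in> carrier_mat k q"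
    and R22: "R22 \<in> carrier_mat q q" and N: "N \<in> carrier_mat k k"
    and inv: "R11 * N = 1\<^sub>m k" "N * R11 = 1\<^sub>m k"
begin

text \<open>Here \<open>N\<close> stands for \<open>R11\<^sup>-\<^sup>1\<close>, and \<open>\<surd>c2\<close> is the factor lost in both inequalities.\<close>

private abbreviation (input) "R \<equiv> four_block_mat R11 R12 (0\<^sub>m q k) R22"
private abbreviation (input) "X \<equiv> N * R12"
private abbreviation (input) "c2 \<equiv> 1 + frob2 X + frob2 N * frob2 R22"

text \<open>
  Substituting \<open>z = a + X d\<close> decouples the blocks, as \<open>R11 X = R12\<close>.
\<close>
lemma block_triangular_norm:
  assumes a: "a \<in> carrier_vec k" and d: "d \<in> carrier_vec q"
  shows "(R *\<^sub>v (a @\<^sub>v d)) \<bullet> (R *\<^sub>v (a @\<^sub>v d))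
    = (R11 *\<^sub>v (a + X *\<^sub>v d)) \<bullet> (R11 *\<^sub>v (a + X *\<^sub>v d)) + (R22 *\<^sub>v d) \<bullet> (R22 *\<^sub>v d)"
proof -
  have "R11 *\<^sub>v (X *\<^sub>v d) = (R11 * N) *\<^sub>v (R12 *\<^sub>v d)"
    using R11 R12 N d by (simp add: assoc_mult_mat_vec[of _ k k _ q] assoc_mult_mat_vec[of _ k k _ k])
  then have "R11 *\<^sub>v (X *\<^sub>v d) = R12 *\<^sub>v d" using inv R12 d by simp
  then have 1: "R11 *\<^sub>v a + R12 *\<^sub>v d = R11 *\<^sub>v (a + X *\<^sub>v d)"
    using R11 R12 N a d by (simp add: mult_add_distrib_mat_vec[of _ k k])
  have 2: "0\<^sub>m q k *\<^sub>v a + R22 *\<^sub>v d = R22 *\<^sub>v d"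
    using R22 a d by (intro eq_vecI) (auto simp: scalar_prod_def)
  show ?thesis
    unfolding four_block_mat_mult_vec[OF R11 R12 zero_carrier_mat R22 a d] 1 2
    using R11 R22 N R12 a d by (intro scalar_prod_append[of _ k _ q]) auto
qed

lemma R11_norm_ge:
  assumes z: "z \<in> carrier_vec k"
  shows "z \<bullet> z \<le> frob2 N * ((R11 *\<^sub>v z) \<bullet> (R11 *\<^sub>v z))"
proof -
  have "N *\<^sub>v (R11 *\<^sub>v z) = z" using R11 N z inv
    by (metis assoc_mult_mat_vec one_mult_mat_vec)
  then show ?thesis using mult_mat_vec_norm_le[OF N, of "R11 *\<^sub>v z"] R11 z by simp
qed

text \<open>
  Let \<open>s = \<sigma>\<^sub>i(R11)\<close> and let \<open>C z = 0\<close> define the subspace on which \<open>R11\<close> stretches by at most \<open>s\<close>.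
  The test subspace consists of all \<open>(a, d)\<close> with \<open>C (a + X d) = 0\<close>; it has the same codimension.
  The contribution of \<open>R22\<close> can be compared with \<open>s\<^sup>2\<close> because \<open>1 \<le> \<parallel>R11\<^sup>-\<^sup>1\<parallel>\<^sup>2 s\<^sup>2\<close>.
\<close>
lemma singular_value_R_le_R11:
  assumes i: "1 \<le> i" "i \<le> k"
  shows "singular_value i R \<le> singular_value i R11 * sqrt c2"
proof -
  let ?s = "singular_value i R11"
  have c2: "0 \<le> c2" using frob2_nonneg by (simp add: add_nonneg_nonneg)
  have s0: "0 \<le> ?s" by (rule singular_value_nonneg[OF R11 _ i]) simp
  obtain C where C: "C \<in> carrier_mat (i - 1) k" and Cb: "\<And>z. z \<in> carrier_vec k
      \<Longrightarrow> C *\<^sub>v z = 0\<^sub>v (i - 1) \<Longrightarrow> (R11 *\<^sub>v z) \<bullet> (R11 *\<^sub>v z) \<le> ?s\<^sup>2 * (z \<bullet> z)"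
    using singular_value_subspaces(1)[OF R11 _ i] by auto
  obtain y where y: "y \<in> carrier_vec k" "0 < y \<bullet> y" "C *\<^sub>v y = 0\<^sub>v (i - 1)"
    using kernel_wide_mat[OF C] scalar_prod_self_pos i by force
  \<comment> \<open>\<open>R11\<close> stretches some nonzero vector by at most \<open>s\<close>, so its inverse has norm at least \<open>1 / s\<close>\<close>
  have "y \<bullet> y \<le> frob2 N * (?s\<^sup>2 * (y \<bullet> y))"
    using R11_norm_ge[OF y(1)] mult_left_mono[OF Cb[OF y(1,3)] frob2_nonneg[of N]] by linarith
  then have one_le: "1 \<le> frob2 N * ?s\<^sup>2" using y(2) by (simp add: mult.assoc[symmetric])
  \<comment> \<open>the constraint \<open>C (a + X d) = 0\<close> as a condition on the pair \<open>(a, d)\<close>\<close>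
  define D where "D = four_block_mat C (C * X) (0\<^sub>m 0 k) (0\<^sub>m 0 q)"
  have D: "D \<in> carrier_mat (i - 1) (k + q)"
    unfolding D_def using C four_block_carrier_mat[of C "i - 1" k "0\<^sub>m 0 q" 0 q] by auto
  show ?thesis
  proof (rule singular_value_leI[OF _ _ _ _ D])
    show "R \<in> carrier_mat (k + q) (k + q)" using R11 R22 by auto
    show "0 \<le> ?s * sqrt c2" using s0 c2 by simp
    fix x :: "real vec" assume x: "x \<in> carrier_vec (k + q)" and Dx: "D *\<^sub>v x = 0\<^sub>v (i - 1)"
    define a d where "a = vec_first x k" and "d = vec_last x q"
    have a: "a \<in> carrier_vec k" and d: "d \<in> carrier_vec q" by (simp_all add: a_def d_def)
    have xad: "x = a @\<^sub>v d" using x by (simp add: a_def d_def)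
    let ?z = "a + X *\<^sub>v d"
    have Xd: "X *\<^sub>v d \<in> carrier_vec k" using N R12 d by auto
    have z: "?z \<in> carrier_vec k" using a Xd by auto
    have "D *\<^sub>v x = (C *\<^sub>v a + (C * X) *\<^sub>v d) @\<^sub>v (0\<^sub>m 0 k *\<^sub>v a + 0\<^sub>m 0 q *\<^sub>v d)"
      unfolding D_def xad by (rule four_block_mat_mult_vec) (use C N R12 a d in auto)
    also have "C *\<^sub>v a + (C * X) *\<^sub>v d = C *\<^sub>v ?z"
      using C N R12 a d Xd by (simp add: mult_add_distrib_mat_vec[of _ "i - 1" k]
          assoc_mult_mat_vec[of C "i - 1" k X q])
    finally have "C *\<^sub>v ?z = 0\<^sub>v (i - 1)"
      using Dx C by (auto simp: vec_eq_iff)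
    note Rz = Cb[OF z this]
    have zz: "?z \<bullet> ?z \<le> (1 + frob2 X) * (a \<bullet> a + d \<bullet> d)"
      using mult_mat_vec_norm_le[of X k q d] N R12 d
      by (intro scalar_prod_self_add_le[OF a Xd] frob2_nonneg scalar_prod_self_nonneg) auto
    have "frob2 R22 \<le> frob2 R22 * (frob2 N * ?s\<^sup>2)"
      using mult_left_mono[OF one_le frob2_nonneg[of R22]] by simp
    from mult_right_mono[OF this scalar_prod_self_nonneg[of d]] have "(R22 *\<^sub>v d) \<bullet> (R22 *\<^sub>v d) \<le> frob2 R22 * (frob2 N * ?s\<^sup>2) * (d \<bullet> d)"
      using mult_mat_vec_norm_le[OF R22 d] by linarith
    also have "\<dots> \<le> frob2 R22 * (frob2 N * ?s\<^sup>2) * (a \<bullet> a + d \<bullet> d)"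
      using frob2_nonneg scalar_prod_self_nonneg[of a] by (intro mult_left_mono) auto
    finally have 22: "(R22 *\<^sub>v d) \<bullet> (R22 *\<^sub>v d) \<le> ?s\<^sup>2 * (frob2 N * frob2 R22 * (a \<bullet> a + d \<bullet> d))"
      by (simp add: mult_ac)
    have "(R *\<^sub>v x) \<bullet> (R *\<^sub>v x) \<le> ?s\<^sup>2 * ((1 + frob2 X) * (a \<bullet> a + d \<bullet> d))
        + ?s\<^sup>2 * (frob2 N * frob2 R22 * (a \<bullet> a + d \<bullet> d))"
      unfolding xad block_triangular_norm[OF a d]
      by (intro add_mono order.trans[OF Rz] mult_left_mono zz 22) auto
    also have "\<dots> = (?s * sqrt c2)\<^sup>2 * (x \<bullet> x)"
      unfolding xad scalar_prod_append[OF a d a d] power_mult_distrib real_sqrt_pow2[OF c2]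
      by (simp add: algebra_simps)
    finally show "(R *\<^sub>v x) \<bullet> (R *\<^sub>v x) \<le> (?s * sqrt c2)\<^sup>2 * (x \<bullet> x)" .
  qed (use i in auto)
qed

text \<open>
  Let \<open>s = \<sigma>\<^sub>j(R22)\<close> and let \<open>C d = 0\<close> define a subspace of dimension \<open>j\<close> on which \<open>R22\<close> stretches by
  at least \<open>s\<close>. The test subspace leaves \<open>a\<close> free, which raises its dimension to \<open>j + k\<close>. In
  \<open>a = z - X d\<close>, the part \<open>z\<close> is controlled by \<open>R11 z\<close> and the part \<open>X d\<close> by \<open>R22 d\<close>.
\<close>
lemma singular_value_R22_le_R:
  assumes j: "1 \<le> j" "j \<le> q"
  shows "singular_value j R22 \<le> singular_value (j + k) R * sqrt c2"
proof -
  let ?s = "singular_value j R22"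
  have c2: "0 < c2" using frob2_nonneg by (simp add: add_pos_nonneg)
  obtain C where C: "C \<in> carrier_mat (q - j) q" and Cb: "\<And>d. d \<in> carrier_vec q
      \<Longrightarrow> C *\<^sub>v d = 0\<^sub>v (q - j) \<Longrightarrow> ?s\<^sup>2 * (d \<bullet> d) \<le> (R22 *\<^sub>v d) \<bullet> (R22 *\<^sub>v d)"
    using singular_value_subspaces(2)[OF R22 _ j] by auto
  obtain y where y: "y \<in> carrier_vec q" "0 < y \<bullet> y" "C *\<^sub>v y = 0\<^sub>v (q - j)"
    using kernel_wide_mat[OF C] scalar_prod_self_pos j by force
  have s2: "?s\<^sup>2 \<le> frob2 R22"
    using order.trans[OF Cb[OF y(1,3)] mult_mat_vec_norm_le[OF R22 y(1)]] y(2) by simp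
  \<comment> \<open>the constraint \<open>C d = 0\<close>, with \<open>a\<close> free\<close>
  define D where "D = four_block_mat (0\<^sub>m (q - j) k) C (0\<^sub>m 0 k) (0\<^sub>m 0 q)"
  have D: "D \<in> carrier_mat (k + q - (j + k)) (k + q)"
    unfolding D_def using four_block_carrier_mat[of "0\<^sub>m (q - j) k" "q - j" k "0\<^sub>m 0 q" 0 q]
    by (simp add: add.commute)
  have "?s / sqrt c2 \<le> singular_value (j + k) R"
  proof (rule singular_value_geI[OF _ _ _ _ D])
    show "R \<in> carrier_mat (k + q) (k + q)" using R11 R22 by auto
    fix x :: "real vec" assume x: "x \<in> carrier_vec (k + q)"
      and Dx: "D *\<^sub>v x = 0\<^sub>v (k + q - (j + k))"
    define a d where "a = vec_first x k" and "d = vec_last x q"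
    have a: "a \<in> carrier_vec k" and d: "d \<in> carrier_vec q" by (simp_all add: a_def d_def)
    have xad: "x = a @\<^sub>v d" using x by (simp add: a_def d_def)
    have "D *\<^sub>v x = (0\<^sub>m (q - j) k *\<^sub>v a + C *\<^sub>v d) @\<^sub>v (0\<^sub>m 0 k *\<^sub>v a + 0\<^sub>m 0 q *\<^sub>v d)"
      unfolding D_def xad by (rule four_block_mat_mult_vec) (use C a d in auto)
    also have "0\<^sub>m (q - j) k *\<^sub>v a + C *\<^sub>v d = C *\<^sub>v d"
      using C a d by (intro eq_vecI) (auto simp: scalar_prod_def)
    finally have "C *\<^sub>v d = 0\<^sub>v (q - j)"
      using Dx C by (auto simp: vec_eq_iff)
    note R22d = Cb[OF d this]
    let ?Xd = "X *\<^sub>v d"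
    let ?z = "a + ?Xd"
    let ?A = "(R11 *\<^sub>v ?z) \<bullet> (R11 *\<^sub>v ?z)" and ?B = "(R22 *\<^sub>v d) \<bullet> (R22 *\<^sub>v d)"
    have Xd: "?Xd \<in> carrier_vec k" using N R12 d by auto
    have z: "?z \<in> carrier_vec k" using a Xd by auto
    have "?s\<^sup>2 * (?z \<bullet> ?z) \<le> frob2 R22 * (frob2 N * ?A)"
      by (intro mult_mono s2 R11_norm_ge[OF z] frob2_nonneg scalar_prod_self_nonneg)
    then have sz: "(?s \<cdot>\<^sub>v ?z) \<bullet> (?s \<cdot>\<^sub>v ?z) \<le> (frob2 N * frob2 R22) * ?A"
      using z by (simp add: power2_eq_square mult_ac)
    have "?s\<^sup>2 * (?Xd \<bullet> ?Xd) \<le> ?s\<^sup>2 * (frob2 X * (d \<bullet> d))"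
      using mult_mat_vec_norm_le[of X k q d] N R12 d by (intro mult_left_mono) auto
    also have "\<dots> \<le> frob2 X * ?B"
      using mult_left_mono[OF R22d frob2_nonneg[of X]] by (simp add: mult_ac)
    finally have sX: "((- ?s) \<cdot>\<^sub>v ?Xd) \<bullet> ((- ?s) \<cdot>\<^sub>v ?Xd) \<le> frob2 X * ?B"
      using Xd by (simp add: power2_eq_square mult_ac)
    have "?s \<cdot>\<^sub>v a = ?s \<cdot>\<^sub>v ?z + (- ?s) \<cdot>\<^sub>v ?Xd"
      using a Xd N by (intro eq_vecI) (auto simp: algebra_simps)
    then have "?s\<^sup>2 * (a \<bullet> a) = (?s \<cdot>\<^sub>v ?z + (- ?s) \<cdot>\<^sub>v ?Xd) \<bullet> (?s \<cdot>\<^sub>v ?z + (- ?s) \<cdot>\<^sub>v ?Xd)"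
      using a by (metis power2_eq_square mult.assoc scalar_prod_smult_left scalar_prod_smult_right
          carrier_vecD smult_carrier_vec)
    also have "\<dots> \<le> (frob2 N * frob2 R22 + frob2 X) * (?A + ?B)"
      using z Xd by (intro scalar_prod_self_add_le[OF _ _ sz sX]
          mult_nonneg_nonneg frob2_nonneg scalar_prod_self_nonneg) auto
    finally have "?s\<^sup>2 * (x \<bullet> x) \<le> (frob2 N * frob2 R22 + frob2 X) * (?A + ?B) + ?B"
      using R22d unfolding xad scalar_prod_append[OF a d a d] by (simp add: algebra_simps)
    also have "\<dots> \<le> c2 * (?A + ?B)"
      using scalar_prod_self_nonneg[of "R11 *\<^sub>v ?z"] by (simp add: algebra_simps)
    also have "?A + ?B = (R *\<^sub>v x) \<bullet> (R *\<^sub>v x)"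
      unfolding xad block_triangular_norm[OF a d] ..
    finally show "(?s / sqrt c2)\<^sup>2 * (x \<bullet> x) \<le> (R *\<^sub>v x) \<bullet> (R *\<^sub>v x)"
      unfolding power_divide real_sqrt_pow2[OF less_imp_le[OF c2]] using c2
      by (simp add: pos_divide_le_eq mult.commute)
  qed (use j in auto)
  then show ?thesis using c2 by (simp add: pos_divide_le_eq)
qed

end

section \<open>Blocks of a triangular factor\<close>

lemma invertible_mat_iff_det:
  fixes A :: "real mat"
  assumes A: "A \<in> carrier_mat k k"
  shows "invertible_mat A \<longleftrightarrow> det A \<noteq> 0"
proof
  assume "invertible_mat A"
  then obtain B where B: "A * B = 1\<^sub>m k" "B * A = 1\<^sub>m (dim_row B)"
    using A unfolding invertible_mat_def inverts_mat_def by auto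
  then have "B \<in> carrier_mat k k" using A
    by (metis carrier_matD(2) carrier_matI index_mult_mat(2,3) index_one_mat(2,3))
  then have "det A * det B = 1" using det_mult[OF A] B(1) by (metis det_one)
  then show "det A \<noteq> 0" by auto
next
  assume d: "det A \<noteq> 0"
  let ?B = "(1 / det A) \<cdot>\<^sub>m adj_mat A"
  have "A * ?B = 1\<^sub>m k" "?B * A = 1\<^sub>m k"
    using adj_mat[OF A] A d by (auto simp: mult_smult_distrib[of _ k k] mult_smult_assoc_mat[of _ k k])
  then show "invertible_mat A"
    using A adj_mat(1)[OF A] unfolding invertible_mat_def inverts_mat_def by auto
qed

lemma the_mat_inverse:
  fixes A :: "real mat"
  assumes A: "A \<in> carrier_mat k k" and inv: "invertible_mat A"
  shows "the (mat_inverse A) \<in> carrier_mat k k"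
    "A * the (mat_inverse A) = 1\<^sub>m k" "the (mat_inverse A) * A = 1\<^sub>m k"
proof -
  have "det A \<noteq> 0" using inv invertible_mat_iff_det[OF A] by simp
  then have "mat_inverse A \<noteq> None"
    using det_non_zero_imp_unit[OF A, of "()"] mat_inverse(1)[OF A, of "()"] by blast
  then obtain B where "mat_inverse A = Some B" by blast
  then show "the (mat_inverse A) \<in> carrier_mat k k"
    "A * the (mat_inverse A) = 1\<^sub>m k" "the (mat_inverse A) * A = 1\<^sub>m k"
    using mat_inverse(2)[OF A] by auto
qed

lemma block11_eq: "block11 k R = mat k k (\<lambda>(i, j). R $$ (i, j))"
  by (simp add: block11_def split_block_def Let_def case_prod_eta)

lemma block12_eq: "block12 k R = mat k (dim_col R - k) (\<lambda>(i, j). R $$ (i, j + k))"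
  by (simp add: block12_def split_block_def Let_def)

lemma block22_eq:
  "block22 k R = mat (dim_row R - k) (dim_col R - k) (\<lambda>(i, j). R $$ (i + k, j + k))"
  by (simp add: block22_def split_block_def Let_def)

lemmas block_eqs = block11_eq block12_eq block22_eq

lemma block_carrier:
  assumes "R \<in> carrier_mat p p"
  shows "block11 k R \<in> carrier_mat k k" "block12 k R \<in> carrier_mat k (p - k)"
    "block22 k R \<in> carrier_mat (p - k) (p - k)"
  using assms by (auto simp: block_eqs)

lemma upper_triangular_blocks:
  fixes R :: "real mat"
  assumes R: "R \<in> carrier_mat p p" "upper_triangular R" and k: "k \<le> p"
  shows "R = four_block_mat (block11 k R) (block12 k R) (0\<^sub>m (p - k) k) (block22 k R)"
  using R k by (intro eq_matI) (auto simp: block_eqs upper_triangular_def)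

section \<open>Gram determinants under column exchanges\<close>

text \<open>The squared volume spanned by the first \<open>k\<close> columns.\<close>

definition gram_det :: "nat \<Rightarrow> real mat \<Rightarrow> real" where
  "gram_det k M = det (mat k k (\<lambda>(a, b). col M a \<bullet> col M b))"

lemma gram_det_orthonormal_mult:
  fixes Q R :: "real mat"
  assumes Q: "Q \<in> carrier_mat n p" "transpose_mat Q * Q = 1\<^sub>m p" and R: "R \<in> carrier_mat p q"
    and k: "k \<le> q"
  shows "gram_det k (Q * R) = gram_det k R"
proof -
  have "transpose_mat (Q * R) * (Q * R) = transpose_mat R * R"
  proof -
    have "transpose_mat (Q * R) * (Q * R) = transpose_mat R * ((transpose_mat Q * Q) * R)"
      using Q(1) R by (simp add: transpose_mult[of _ n p] assoc_mult_mat[of _ q p _ n _ q]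
          assoc_mult_mat[of _ p n _ p _ q])
    then show ?thesis using Q R by simp
  qed
  then have eq: "(transpose_mat (Q * R) * (Q * R)) $$ (a, b) = (transpose_mat R * R) $$ (a, b)" for a b
    by simp
  have "col (Q * R) a \<bullet> col (Q * R) b = col R a \<bullet> col R b" if "a < k" "b < k" for a b
    using eq[of a b] that k Q(1) R by simp
  then show ?thesis unfolding gram_det_def by (intro arg_cong[of _ _ det] cong_mat) auto
qed

text \<open>
  The first \<open>k\<close> columns of \<open>R\<close> vanish below row \<open>k\<close>, so their Gram matrix is \<open>R11\<^sup>T R11\<close>.
\<close>
lemma gram_det_upper_triangular:
  fixes R :: "real mat"
  assumes R: "R \<in> carrier_mat p p" "upper_triangular R" and k: "k \<le> p"
  shows "gram_det k R = (det (block11 k R))\<^sup>2"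
proof -
  let ?B = "block11 k R"
  have B: "?B \<in> carrier_mat k k" by (rule block_carrier) fact
  have "col R a \<bullet> col R b = col ?B a \<bullet> col ?B b" if ab: "a < k" "b < k" for a b
  proof -
    have "col R a \<bullet> col R b = (\<Sum>l<p. R $$ (l, a) * R $$ (l, b))"
      using ab R k by (simp add: scalar_prod_def lessThan_atLeast0)
    also have "\<dots> = (\<Sum>l<k. R $$ (l, a) * R $$ (l, b))"
      using ab R k by (intro sum.mono_neutral_right) (auto simp: upper_triangular_def)
    also have "\<dots> = col ?B a \<bullet> col ?B b"
      using ab by (simp add: scalar_prod_def lessThan_atLeast0 block_eqs)
    finally show ?thesis .
  qed
  then have "mat k k (\<lambda>(a, b). col R a \<bullet> col R b) = transpose_mat ?B * ?B"
    using B by (intro eq_matI) auto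
  then show ?thesis
    unfolding gram_det_def using B by (simp add: det_mult[of _ k] det_transpose power2_eq_square)
qed

text \<open>
  The determinant is affine in each entry, with the cofactor as slope.
\<close>
lemma det_add_to_diagonal_entry:
  fixes A :: "real mat"
  assumes A: "A \<in> carrier_mat k k" and i: "i < k"
  shows "det (mat k k (\<lambda>(a, b). A $$ (a, b) + (if a = i \<and> b = i then g else 0)))
    = det A + g * cofactor A i i"
proof -
  let ?B = "mat k k (\<lambda>(a, b). A $$ (a, b) + (if a = i \<and> b = i then g else 0))"
  have cof: "cofactor ?B a i = cofactor A a i" if "a < k" for a
  proof -
    have "mat_delete ?B a i = mat_delete A a i"
      using A i that by (intro eq_matI) (auto simp: mat_delete_def)
    then show ?thesis by (simp add: cofactor_def)
  qed
  have "det ?B = (\<Sum>a<k. ?B $$ (a, i) * cofactor ?B a i)"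
    by (rule laplace_expansion_column) (use i in auto)
  also have "\<dots> = (\<Sum>a<k. A $$ (a, i) * cofactor A a i + (if a = i then g * cofactor A i i else 0))"
    using i by (intro sum.cong) (auto simp: cof algebra_simps)
  also have "\<dots> = det A + g * cofactor A i i"
    using i by (simp add: sum.distrib laplace_expansion_column[OF A i])
  finally show ?thesis .
qed

text \<open>
  Cramer's rule for the inverse \<open>N N\<^sup>T\<close> of \<open>B\<^sup>T B\<close>.
\<close>
lemma cofactor_gram:
  fixes B N :: "real mat"
  assumes B: "B \<in> carrier_mat k k" and N: "N \<in> carrier_mat k k"
    and inv: "B * N = 1\<^sub>m k" "N * B = 1\<^sub>m k" and i: "i < k"
  shows "cofactor (transpose_mat B * B) i i = (det B)\<^sup>2 * (row N i \<bullet> row N i)"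
proof -
  let ?G = "transpose_mat B * B" and ?H = "N * transpose_mat N"
  have G: "?G \<in> carrier_mat k k" and H: "?H \<in> carrier_mat k k"
    and BT: "transpose_mat B \<in> carrier_mat k k" and NT: "transpose_mat N \<in> carrier_mat k k"
    using B N by auto
  have "?G * ?H = transpose_mat B * ((B * N) * transpose_mat N)"
    using B N BT NT by (simp add: assoc_mult_mat[of _ k k _ k _ k])
  also have "\<dots> = transpose_mat (N * B)" using B N NT by (simp add: inv(1) transpose_mult[of _ k k])
  finally have GH: "?G * ?H = 1\<^sub>m k" by (simp add: inv)
  have "adj_mat ?G = adj_mat ?G * (?G * ?H)" using adj_mat(1)[OF G] by (simp add: GH)
  also have "\<dots> = (adj_mat ?G * ?G) * ?H"
    by (rule assoc_mult_mat[symmetric]) (use adj_mat(1)[OF G] G H in auto)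
  also have "\<dots> = det ?G \<cdot>\<^sub>m ?H"
    unfolding adj_mat(3)[OF G] mult_smult_assoc_mat[OF one_carrier_mat H] left_mult_one_mat[OF H] ..
  finally have "adj_mat ?G $$ (i, i) = det ?G * ?H $$ (i, i)" using N i by simp
  moreover have "adj_mat ?G $$ (i, i) = cofactor ?G i i" using B i by (simp add: adj_mat_def)
  moreover have "det ?G = (det B)\<^sup>2"
    using B by (simp add: det_mult[of _ k] det_transpose power2_eq_square)
  moreover have "?H $$ (i, i) = row N i \<bullet> row N i" using N i by simp
  ultimately show ?thesis by simp
qed

lemma col_mult_swaprows_mat:
  fixes A :: "real mat"
  assumes A: "A \<in> carrier_mat n p" and ij: "i < p" "j < p" and a: "a < p"
  shows "col (A * swaprows_mat p i j) a = col A (Transposition.transpose i j a)"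
proof -
  have t: "Transposition.transpose i j a < p" using ij a by (auto simp: Transposition.transpose_def)
  have "col (swaprows_mat p i j) a = unit_vec p (Transposition.transpose i j a)"
    using ij a by (intro eq_vecI) (auto simp: Transposition.transpose_def)
  then have "col (A * swaprows_mat p i j) a = A *\<^sub>v unit_vec p (Transposition.transpose i j a)"
    using col_mult2[OF A swaprows_mat_carrier a, of i j] by metis
  also have "\<dots> = col A (Transposition.transpose i j a)"
    using A t by (intro eq_vecI) auto
  finally show ?thesis .
qed

lemma srrqr_rho_square:
  "(srrqr_rho k R i j)\<^sup>2 = ((the (mat_inverse (block11 k R)) * block12 k R) $$ (i, j))\<^sup>2
    + (col (block22 k R) j \<bullet> col (block22 k R) j)
      * (row (the (mat_inverse (block11 k R))) i \<bullet> row (the (mat_inverse (block11 k R))) i)"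
  by (simp add: srrqr_rho_def Let_def vec_norm2_def power_mult_distrib scalar_prod_self_nonneg)

text \<open>
  After the exchange, the first \<open>k\<close> columns consist of an upper part \<open>T\<close>, which is \<open>R11\<close> with column
  \<open>i\<close> replaced by \<open>R12 e\<^sub>j\<close>, and a lower part whose only nonzero column is column \<open>i\<close>, equal to
  \<open>R22 e\<^sub>j\<close>. Their Gram matrix is thus \<open>T\<^sup>T T\<close> with \<open>g = \<parallel>R22 e\<^sub>j\<parallel>\<^sup>2\<close> added to the diagonal entry
  \<open>(i, i)\<close>. Its determinant is \<open>(det T)\<^sup>2\<close> plus \<open>g\<close> times a cofactor. Cramer's rule gives
  \<open>det T = (R11\<^sup>-\<^sup>1 R12)\<^sub>i\<^sub>j det R11\<close>, and since the cofactor ignores column \<open>i\<close>, it can be computed with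
  \<open>R11\<close> in place of \<open>T\<close>, where it equals \<open>(det R11)\<^sup>2 \<parallel>e\<^sub>i\<^sup>T R11\<^sup>-\<^sup>1\<parallel>\<^sup>2\<close>. The two terms are the two
  summands of \<open>\<rho>\<^sub>i\<^sub>j\<^sup>2\<close>.
\<close>
lemma gram_det_swap:
  fixes R :: "real mat"
  assumes R: "R \<in> carrier_mat p p" "upper_triangular R" and inv: "invertible_mat (block11 k R)"
    and i: "i < k" and j: "j < p - k"
  shows "gram_det k (R * swaprows_mat p i (j + k)) = (srrqr_rho k R i j)\<^sup>2 * gram_det k R"
proof -
  let ?B = "block11 k R" and ?C = "block12 k R" and ?D = "block22 k R"
  let ?M = "R * swaprows_mat p i (j + k)"
  have k: "k \<le> p" and jp: "j + k < p" using j by auto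
  have B: "?B \<in> carrier_mat k k" and C: "?C \<in> carrier_mat k (p - k)"
    and D: "?D \<in> carrier_mat (p - k) (p - k)" using block_carrier[OF R(1)] by auto
  define N where "N = the (mat_inverse ?B)"
  have N: "N \<in> carrier_mat k k" "?B * N = 1\<^sub>m k" "N * ?B = 1\<^sub>m k"
    unfolding N_def using the_mat_inverse[OF B inv] by auto
  define g where "g = col ?D j \<bullet> col ?D j"
  define T where "T = replace_col ?B (col ?C j) i"
  have T: "T \<in> carrier_mat k k" using B by (simp add: T_def replace_col_def)
  define G where "G = transpose_mat T * T"
  have G: "G \<in> carrier_mat k k" using T by (simp add: G_def)
  have colM: "col ?M a = col R (if a = i then j + k else a)" if "a < k" for a
    using col_mult_swaprows_mat[OF R(1), of i "j + k" a] that i j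
    by (auto simp: Transposition.transpose_def)
  have entry: "col ?M a \<bullet> col ?M b = G $$ (a, b) + (if a = i \<and> b = i then g else 0)"
    if ab: "a < k" "b < k" for a b
  proof -
    \<comment> \<open>the columns of \<open>R\<close> that the exchange moves to positions \<open>a\<close> and \<open>b\<close>\<close>
    define a' b' where "a' = (if a = i then j + k else a)" and "b' = (if b = i then j + k else b)"
    have ab': "a' < p" "b' < p" using ab jp k by (auto simp: a'_def b'_def)
    have "{..<p} = {..<k} \<union> {k..<p}" using k by auto
    then have "col ?M a \<bullet> col ?M b = (\<Sum>l\<in>{..<k} \<union> {k..<p}. R $$ (l, a') * R $$ (l, b'))"
      unfolding colM[OF ab(1)] colM[OF ab(2)] a'_def[symmetric] b'_def[symmetric]
      using ab' R k by (auto simp: scalar_prod_def lessThan_atLeast0 intro!: sum.cong)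
    also have "\<dots> = (\<Sum>l<k. R $$ (l, a') * R $$ (l, b')) + (\<Sum>l=k..<p. R $$ (l, a') * R $$ (l, b'))"
      by (rule sum.union_disjoint) auto
    also have "(\<Sum>l<k. R $$ (l, a') * R $$ (l, b')) = G $$ (a, b)"
      unfolding G_def using T ab R(1) i j
      by (auto simp: scalar_prod_def lessThan_atLeast0 T_def replace_col_def block_eqs a'_def b'_def
          intro!: sum.cong)
    also have "(\<Sum>l=k..<p. R $$ (l, a') * R $$ (l, b')) = (if a = i \<and> b = i then g else 0)"
    proof (cases "a = i \<and> b = i")
      case True
      have "(\<Sum>l=k..<p. R $$ (l, a') * R $$ (l, b')) = (\<Sum>l=0..<p - k. R $$ (l + k, a') * R $$ (l + k, b'))"
        using sum.shift_bounds_nat_ivl[of "\<lambda>l. R $$ (l, a') * R $$ (l, b')" 0 k "p - k"] k by simp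
      also have "\<dots> = g"
        unfolding g_def using True R(1) j by (simp add: scalar_prod_def block_eqs a'_def b'_def)
      finally show ?thesis using True by simp
    next
      case False
      then have "R $$ (l, a') = 0 \<or> R $$ (l, b') = 0" if "l \<in> {k..<p}" for l
        using that R ab by (auto simp: a'_def b'_def upper_triangular_def)
      then show ?thesis using False by (auto intro!: sum.neutral)
    qed
    finally show ?thesis .
  qed
  have "gram_det k ?M = det (mat k k (\<lambda>(a, b). G $$ (a, b) + (if a = i \<and> b = i then g else 0)))"
    unfolding gram_det_def by (intro arg_cong[of _ _ det] cong_mat) (auto simp: entry)
  also have "\<dots> = det G + g * cofactor G i i" by (rule det_add_to_diagonal_entry[OF G i])
  also have "cofactor G i i = cofactor (transpose_mat ?B * ?B) i i"
  proof -
    have "mat_delete G i i = mat_delete (transpose_mat ?B * ?B) i i"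
    proof (rule eq_matI)
      fix a b assume "a < dim_row (mat_delete (transpose_mat ?B * ?B) i i)"
        "b < dim_col (mat_delete (transpose_mat ?B * ?B) i i)"
      then have ab: "a < k - 1" "b < k - 1" using B by auto
      have "col T c = col ?B c" if "c < k" "c \<noteq> i" for c
        using that T B by (intro eq_vecI) (auto simp: T_def replace_col_def)
      then show "mat_delete G i i $$ (a, b) = mat_delete (transpose_mat ?B * ?B) i i $$ (a, b)"
        using ab T B by (simp add: mat_delete_def G_def)
    qed (use G B in auto)
    then show ?thesis by (simp add: cofactor_def)
  qed
  also have "\<dots> = (det ?B)\<^sup>2 * (row N i \<bullet> row N i)"
    by (rule cofactor_gram) (use B N i in auto)
  also have "det G = (det T)\<^sup>2"
    unfolding G_def using T by (simp add: det_mult[of _ k] det_transpose power2_eq_square)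
  also have "det T = (N * ?C) $$ (i, j) * det ?B"
  proof -
    have cj: "col ?C j \<in> carrier_vec k" using C by (intro carrier_vecI) simp
    have x: "N *\<^sub>v col ?C j \<in> carrier_vec k" using N(1) by (intro carrier_vecI) simp
    have "?B *\<^sub>v (N *\<^sub>v col ?C j) = (?B * N) *\<^sub>v col ?C j"
      by (rule assoc_mult_mat_vec[symmetric]) (use B N cj in auto)
    also have "\<dots> = col ?C j" unfolding N(2) using cj by simp
    finally have "T = replace_col ?B (?B *\<^sub>v (N *\<^sub>v col ?C j)) i" by (simp add: T_def)
    then have "det T = (N *\<^sub>v col ?C j) $ i * det ?B"
      using cramer_lemma_mat[OF B x i] by simp
    moreover have "(N *\<^sub>v col ?C j) $ i = (N * ?C) $$ (i, j)" using N C i j by simp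
    ultimately show ?thesis by simp
  qed
  finally have "gram_det k ?M
      = (((N * ?C) $$ (i, j))\<^sup>2 + g * (row N i \<bullet> row N i)) * (det ?B)\<^sup>2"
    by (simp add: algebra_simps)
  moreover have "(srrqr_rho k R i j)\<^sup>2 = ((N * ?C) $$ (i, j))\<^sup>2 + g * (row N i \<bullet> row N i)"
    unfolding N_def g_def by (rule srrqr_rho_square)
  ultimately show ?thesis unfolding gram_det_upper_triangular[OF R k] by simp
qed

section \<open>Permutations and pivoted QR decompositions\<close>

lemma permutation_mat_swaprows:
  assumes P: "permutation_mat p P" and ij: "i < p" "j < p"
  shows "permutation_mat p (P * swaprows_mat p i j)"
proof -
  obtain \<pi> where \<pi>: "\<pi> permutes {..<p}" and P_eq: "P = mat p p (\<lambda>(i, j). if i = \<pi> j then 1 else 0)"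
    using P unfolding permutation_mat_def by blast
  let ?t = "Transposition.transpose i j"
  have Pc: "P \<in> carrier_mat p p" by (simp add: P_eq)
  have "P * swaprows_mat p i j = mat p p (\<lambda>(a, b). if a = (\<pi> \<circ> ?t) b then 1 else 0)"
  proof (rule eq_matI)
    fix a b assume "a < dim_row (mat p p (\<lambda>(a, b). if a = (\<pi> \<circ> ?t) b then 1 else (0 :: real)))"
      "b < dim_col (mat p p (\<lambda>(a, b). if a = (\<pi> \<circ> ?t) b then 1 else (0 :: real)))"
    then have ab: "a < p" "b < p" by auto
    have t: "?t b < p" using ij ab by (auto simp: Transposition.transpose_def)
    have "(P * swaprows_mat p i j) $$ (a, b) = col (P * swaprows_mat p i j) b $ a"
      using ab Pc by simp
    also have "\<dots> = col P (?t b) $ a" unfolding col_mult_swaprows_mat[OF Pc ij ab(2)] ..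
    also have "\<dots> = mat p p (\<lambda>(a, b). if a = (\<pi> \<circ> ?t) b then 1 else 0) $$ (a, b)"
      using ab t by (simp add: P_eq)
    finally show "(P * swaprows_mat p i j) $$ (a, b)
      = mat p p (\<lambda>(a, b). if a = (\<pi> \<circ> ?t) b then 1 else 0) $$ (a, b)" .
  qed (use Pc in auto)
  moreover have "\<pi> \<circ> ?t permutes {..<p}"
    by (rule permutes_compose[OF permutes_swap_id \<pi>]) (use ij in auto)
  ultimately show ?thesis unfolding permutation_mat_def by blast
qed

lemma permutation_mat_orthogonal:
  assumes "permutation_mat p P"
  shows "P \<in> carrier_mat p p" "transpose_mat P * P = 1\<^sub>m p"
proof -
  obtain \<pi> where \<pi>: "\<pi> permutes {..<p}" and P_eq: "P = mat p p (\<lambda>(i, j). if i = \<pi> j then 1 else 0)"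
    using assms unfolding permutation_mat_def by blast
  show P: "P \<in> carrier_mat p p" by (simp add: P_eq)
  have lt: "\<pi> a < p" if "a < p" for a using permutes_in_image[OF \<pi>] that by simp
  have col: "col P a = unit_vec p (\<pi> a)" if "a < p" for a
    using that lt[OF that] by (intro eq_vecI) (auto simp: P_eq)
  have inj: "\<pi> a = \<pi> b \<longleftrightarrow> a = b" for a b using permutes_inj[OF \<pi>] by (auto dest: injD)
  show "transpose_mat P * P = 1\<^sub>m p"
    using P by (intro eq_matI) (auto simp: col lt inj)
qed

lemma finite_permutation_mats: "finite {P. permutation_mat p P}"
proof -
  have "{P. permutation_mat p P}
      \<subseteq> (\<lambda>\<pi>. mat p p (\<lambda>(i, j). if i = \<pi> j then 1 else 0)) ` {\<pi>. \<pi> permutes {..<p}}"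
    unfolding permutation_mat_def by blast
  then show ?thesis by (rule finite_subset) (simp add: finite_permutations)
qed

lemma pivoted_qrD:
  assumes "pivoted_qr S P Q R" and S: "S \<in> carrier_mat n p"
  shows "permutation_mat p P" "Q \<in> carrier_mat n p" "transpose_mat Q * Q = 1\<^sub>m p"
    "R \<in> carrier_mat p p" "upper_triangular R" "\<forall>i<p. 0 \<le> R $$ (i, i)" "S * P = Q * R"
  using assms unfolding pivoted_qr_def Let_def by auto

lemma unpivoted_qrD:
  assumes "unpivoted_qr A Q R" and A: "A \<in> carrier_mat n p"
  shows "Q \<in> carrier_mat n p" "transpose_mat Q * Q = 1\<^sub>m p"
    "R \<in> carrier_mat p p" "upper_triangular R" "\<forall>i<p. 0 \<le> R $$ (i, i)" "A = Q * R"
  using pivoted_qrD[OF assms(1)[unfolded unpivoted_qr_def] A] A by auto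

lemma one_mat_permutation: "permutation_mat p (1\<^sub>m p)"
  unfolding permutation_mat_def by (rule exI[of _ id]) (auto simp: permutes_id)

lemma pivoted_qr_exists:
  assumes S: "S \<in> carrier_mat n p" and "p \<le> n" and P: "permutation_mat p P"
  shows "\<exists>Q R. pivoted_qr S P Q R"
proof -
  have "S * P \<in> carrier_mat n p" using S permutation_mat_orthogonal(1)[OF P] by simp
  from qr_exists[OF this \<open>p \<le> n\<close>] show ?thesis
    using S P unfolding pivoted_qr_def Let_def by auto
qed

lemma unpivoted_qr_exists:
  assumes "A \<in> carrier_mat n p" and "p \<le> n"
  shows "\<exists>Q R. unpivoted_qr A Q R"
  using pivoted_qr_exists[OF assms one_mat_permutation] assms unfolding unpivoted_qr_def by auto

lemma pivoted_qr_update: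
  assumes S: "S \<in> carrier_mat n p" and qr: "pivoted_qr S P Q R" and ij: "i < p" "j < p"
    and new: "unpivoted_qr (R * swaprows_mat p i j) Qt Rt"
  shows "pivoted_qr S (P * swaprows_mat p i j) (Q * Qt) Rt"
proof -
  let ?P = "swaprows_mat p i j :: real mat"
  note 1 = pivoted_qrD[OF qr S]
  have "R * ?P \<in> carrier_mat p p" using 1 by simp
  note 2 = unpivoted_qrD[OF new this]
  have P: "P \<in> carrier_mat p p" using permutation_mat_orthogonal(1)[OF 1(1)] .
  have Pij: "?P \<in> carrier_mat p p" by simp
  have "S * (P * ?P) = (S * P) * ?P" by (rule assoc_mult_mat[symmetric, OF S P Pij])
  also have "\<dots> = Q * (R * ?P)" unfolding 1(7) by (rule assoc_mult_mat[OF 1(2,4) Pij])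
  also have "\<dots> = (Q * Qt) * Rt" unfolding 2(6) by (rule assoc_mult_mat[symmetric, OF 1(2) 2(1,3)])
  finally have "S * (P * ?P) = (Q * Qt) * Rt" .
  moreover have "transpose_mat (Q * Qt) * (Q * Qt) = 1\<^sub>m p"
  proof -
    have "transpose_mat (Q * Qt) * (Q * Qt) = transpose_mat Qt * ((transpose_mat Q * Q) * Qt)"
      using 1(2) 2(1) by (simp add: transpose_mult[of _ n p] assoc_mult_mat[of _ p p _ n _ p]
          assoc_mult_mat[of _ p n _ p _ p])
    then show ?thesis using 1(2,3) 2(1,2) by simp
  qed
  ultimately show ?thesis
    using S 1 2 permutation_mat_swaprows[OF 1(1) ij] unfolding pivoted_qr_def Let_def by auto
qed

section \<open>Progress and termination of the algorithm\<close>

text \<open>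
  The Gram determinant of the selected columns is positive exactly when \<open>R11\<close> is nonsingular, so its
  growth by the factor \<open>\<rho>\<^sub>i\<^sub>j\<^sup>2 > 1\<close> preserves the invariant as well as driving the termination proof.
\<close>
lemma srrqr_step_progress:
  assumes S: "S \<in> carrier_mat n p" and f: "1 \<le> f"
    and qr: "pivoted_qr S P Q R" and inv: "invertible_mat (block11 k R)"
    and step: "srrqr_step k f (P, Q, R) (P', Q', R')"
  shows "pivoted_qr S P' Q' R'" "invertible_mat (block11 k R')"
    "gram_det k (S * P) < gram_det k (S * P')"
proof -
  note 1 = pivoted_qrD[OF qr S]
  have "dim_col R = p" using 1 by simp
  with step obtain i j Qt where i: "i < k" and j: "j < p - k" and \<rho>: "f < srrqr_rho k R i j"
    and P': "P' = P * swaprows_mat p i (j + k)"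
    and Qt: "Q' = Q * Qt" "unpivoted_qr (R * swaprows_mat p i (j + k)) Qt R'"
    by (cases rule: srrqr_step.cases) auto
  have k: "k \<le> p" "i < p" "j + k < p" using i j by auto
  show qr'': "pivoted_qr S P' Q' R'"
    unfolding P' Qt(1) by (rule pivoted_qr_update[OF S qr k(2,3) Qt(2)])
  note 2 = pivoted_qrD[OF qr'' S]
  have c: "R * swaprows_mat p i (j + k) \<in> carrier_mat p p" using 1 by simp
  note 3 = unpivoted_qrD[OF Qt(2) c]
  have "gram_det k R' = gram_det k (R * swaprows_mat p i (j + k))"
    unfolding 3(6) by (rule gram_det_orthonormal_mult[symmetric, OF 3(1,2,3) k(1)])
  also have "\<dots> = (srrqr_rho k R i j)\<^sup>2 * gram_det k R"
    by (rule gram_det_swap[OF 1(4,5) inv i j])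
  finally have g: "gram_det k R' = (srrqr_rho k R i j)\<^sup>2 * gram_det k R" .
  have pos: "0 < gram_det k R"
    using gram_det_upper_triangular[OF 1(4,5) k(1)] inv
      invertible_mat_iff_det[OF block_carrier(1)[OF 1(4)]] by simp
  have "1 < (srrqr_rho k R i j)\<^sup>2" using \<rho> f by (simp add: one_less_power)
  then have less: "gram_det k R < gram_det k R'" using g pos by simp
  then have "gram_det k R' \<noteq> 0" using pos by linarith
  then show "invertible_mat (block11 k R')"
    unfolding gram_det_upper_triangular[OF 2(4,5) k(1)]
      invertible_mat_iff_det[OF block_carrier(1)[OF 2(4)]] by simp
  show "gram_det k (S * P) < gram_det k (S * P')"
    unfolding 1(7) 2(7) gram_det_orthonormal_mult[OF 1(2,3,4) k(1)]
      gram_det_orthonormal_mult[OF 2(2,3,4) k(1)] by (rule less)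
qed

lemma srrqr_reachable_invariant:
  assumes S: "S \<in> carrier_mat n p" and f: "1 \<le> f" and "srrqr_reachable S k f (P, Q, R)"
  shows "pivoted_qr S P Q R" "invertible_mat (block11 k R)"
proof -
  obtain s0 where s0: "srrqr_initial S k s0" and steps: "(srrqr_step k f)\<^sup>*\<^sup>* s0 (P, Q, R)"
    using assms(3) unfolding srrqr_reachable_def by blast
  from steps have "srrqr_initial S k (P, Q, R)"
  proof (induction "(P, Q, R)" arbitrary: P Q R rule: rtranclp_induct)
    case base
    then show ?case using s0 by simp
  next
    case (step y)
    obtain P' Q' R' where y: "y = (P', Q', R')" by (cases y)
    then show ?case
      using step srrqr_step_progress(1,2)[OF S f, of P' Q' R' k P Q R]
      by (auto simp: srrqr_initial_def)
  qed
  then show "pivoted_qr S P Q R" "invertible_mat (block11 k R)"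
    by (auto simp: srrqr_initial_def)
qed

text \<open>
  The determinant depends on the state only through its permutation matrix, so an infinite run would
  visit infinitely many distinct permutation matrices.
\<close>
lemma srrqr_terminates:
  assumes S: "S \<in> carrier_mat n p" and f: "1 \<le> f"
  shows "srrqr_terminates S k f"
  unfolding srrqr_terminates_def
proof
  assume "\<exists>s. srrqr_initial S k (s 0) \<and> (\<forall>t::nat. srrqr_step k f (s t) (s (Suc t)))"
  then obtain s where s0: "srrqr_initial S k (s 0)"
    and step: "\<And>t::nat. srrqr_step k f (s t) (s (Suc t))" by blast
  have inv: "srrqr_initial S k (s t)" for t
  proof (induction t)
    case (Suc t)
    obtain P Q R P' Q' R' where "s t = (P, Q, R)" "s (Suc t) = (P', Q', R')"
      by (metis prod_cases3)
    then show ?case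
      using Suc step[of t] srrqr_step_progress(1,2)[OF S f, of P Q R k P' Q' R']
      by (auto simp: srrqr_initial_def)
  qed (rule s0)
  let ?g = "\<lambda>t. gram_det k (S * fst (s t))"
  have "?g t < ?g (Suc t)" for t
  proof -
    obtain P Q R P' Q' R' where "s t = (P, Q, R)" "s (Suc t) = (P', Q', R')"
      by (metis prod_cases3)
    then show ?thesis
      using inv[of t] step[of t] srrqr_step_progress(3)[OF S f, of P Q R k P' Q' R']
      by (auto simp: srrqr_initial_def)
  qed
  then have "strict_mono ?g" by (simp add: strict_mono_Suc_iff)
  then have "inj ?g" by (rule strict_mono_imp_inj_on)
  then have "inj (\<lambda>t. fst (s t))" by (metis (no_types, lifting) injD injI)
  moreover have "permutation_mat p (fst (s t))" for t
    using inv[of t] pivoted_qrD(1)[OF _ S] by (cases "s t") (auto simp: srrqr_initial_def)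
  then have "range (\<lambda>t. fst (s t)) \<subseteq> {P. permutation_mat p P}" by blast
  then have "finite (range (\<lambda>t. fst (s t)))" using finite_permutation_mats finite_subset by blast
  ultimately show False using finite_imageD infinite_UNIV_nat by blast
qed

section \<open>Existence of an initial decomposition\<close>

text \<open>
  The rank provides \<open>k\<close> linearly independent columns; the permutation \<open>\<pi>\<close> moves them to the front by
  extending a bijection between \<open>{..<k}\<close> and the set of their indices.
\<close>
lemma independent_cols_permutation:
  fixes S :: "real mat"
  assumes S: "S \<in> carrier_mat n p" and k: "k \<le> vec_space.rank n S"
  obtains \<pi> where "\<pi> permutes {..<p}" "k \<le> p"
    "\<And>y. y \<in> carrier_vec k \<Longrightarrow> mat n k (\<lambda>(a, b). S $$ (a, \<pi> b)) *\<^sub>v y = 0\<^sub>v n \<Longrightarrow> y = 0\<^sub>v k"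
proof -
  interpret vec_space "TYPE(real)" n .
  have colsS: "set (cols S) \<subseteq> carrier_vec n" using S cols_dim by blast
  obtain B where B: "maximal B (\<lambda>T. T \<subseteq> set (cols S) \<and> lin_indpt T)"
    using maximal_exists_superset[of "set (cols S)" "\<lambda>T. T \<subseteq> set (cols S) \<and> lin_indpt T" "{}"]
    by (auto simp: lin_dep_def)
  then have B': "B \<subseteq> set (cols S)" "lin_indpt B" by (auto simp: maximal_def)
  have "k \<le> card B" using k rank_card_indpt[OF S B] by simp
  then obtain U where U: "U \<subseteq> B" "card U = k" "finite U" using obtain_subset_with_card_n by metis
  have li: "lin_indpt U" using subset_li_is_li[OF B'(2) U(1)] .
  have "\<exists>c<p. col S c = u" if "u \<in> U" for u
  proof -
    have "u \<in> set (cols S)" using that U B' by auto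
    then show ?thesis using S by (auto simp: cols_def)
  qed
  then obtain c where c: "\<And>u. u \<in> U \<Longrightarrow> c u < p" "\<And>u. u \<in> U \<Longrightarrow> col S (c u) = u" by metis
  have injc: "inj_on c U" using c(2) by (metis inj_onI)
  define I where "I = c ` U"
  have I: "I \<subseteq> {..<p}" "card I = k" using c injc U by (auto simp: I_def card_image)
  then have kp: "k \<le> p" using card_mono[of "{..<p}" I] by simp
  obtain h where h: "bij_betw h {..<k} I"
    using finite_same_card_bij[of "{..<k}" I] I finite_subset[of I] by auto
  have "card ({..<p} - I) = p - k" using I by (subst card_Diff_subset) (auto intro: finite_subset)
  then obtain h' where h': "bij_betw h' {k..<p} ({..<p} - I)"
    using finite_same_card_bij[of "{k..<p}" "{..<p} - I"] by auto
  define \<pi> where "\<pi> = (\<lambda>x. if x < k then h x else if x < p then h' x else x)"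
  have "bij_betw \<pi> ({..<k} \<union> {k..<p}) (I \<union> ({..<p} - I))"
  proof (rule bij_betw_combine)
    show "bij_betw \<pi> {..<k} I" using h by (rule bij_betw_cong[THEN iffD1, rotated]) (simp add: \<pi>_def)
    show "bij_betw \<pi> {k..<p} ({..<p} - I)"
      using h' by (rule bij_betw_cong[THEN iffD1, rotated]) (simp add: \<pi>_def)
  qed auto
  moreover have "{..<k} \<union> {k..<p} = {..<p}" "I \<union> ({..<p} - I) = {..<p}" using kp I by auto
  ultimately have perm: "\<pi> permutes {..<p}"
    using kp by (intro bij_imp_permutes) (auto simp: \<pi>_def)
  let ?S1 = "mat n k (\<lambda>(a, b). S $$ (a, \<pi> b))"
  have col1: "col ?S1 b = col S (h b)" if "b < k" for b
    using that h I(1) S by (intro eq_vecI) (auto simp: \<pi>_def bij_betw_def)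
  have Sc: "bij_betw (col S) I U"
    unfolding I_def bij_betw_def using c by (auto simp: inj_on_def image_image)
  have bij: "bij_betw (\<lambda>b. col ?S1 b) {..<k} U"
    using bij_betw_trans[OF h Sc]
    by (rule bij_betw_cong[THEN iffD1, rotated]) (simp only: col1 lessThan_iff o_apply)
  have cols1: "cols ?S1 = map (col ?S1) [0..<k]" by (simp add: cols_def)
  have dist: "distinct (cols ?S1)"
    using bij unfolding cols1 by (simp add: distinct_map bij_betw_def lessThan_atLeast0)
  have set1: "set (cols ?S1) = U"
    using bij unfolding cols1 by (simp add: bij_betw_def lessThan_atLeast0)
  have "y = 0\<^sub>v k" if "y \<in> carrier_vec k" "?S1 *\<^sub>v y = 0\<^sub>v n" for y
    using lin_depI[OF _ that(1) _ that(2) dist] li unfolding set1 by auto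
  then show ?thesis using that[OF perm kp] by blast
qed

text \<open>
  A kernel vector \<open>y\<close> of \<open>R11\<close>, padded with zeros, is annihilated by \<open>R\<close> and hence by
  \<open>S P = Q R\<close>; this would be a linear dependence between the first \<open>k\<close> columns of \<open>S P\<close>.
\<close>
lemma srrqr_initial_exists:
  assumes S: "S \<in> carrier_mat n p" and "p \<le> n" and k: "k \<le> vec_space.rank n S"
  shows "\<exists>s. srrqr_initial S k s"
proof -
  obtain \<pi> where \<pi>: "\<pi> permutes {..<p}" "k \<le> p"
    and ind: "\<And>y. y \<in> carrier_vec k \<Longrightarrow> mat n k (\<lambda>(a, b). S $$ (a, \<pi> b)) *\<^sub>v y = 0\<^sub>v n \<Longrightarrow> y = 0\<^sub>v k"
    using independent_cols_permutation[OF S k] by metis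
  define P where "P = mat p p (\<lambda>(i, j). if i = \<pi> j then 1 else (0 :: real))"
  have perm: "permutation_mat p P" unfolding permutation_mat_def P_def using \<pi> by blast
  obtain Q R where qr: "pivoted_qr S P Q R" using pivoted_qr_exists[OF S \<open>p \<le> n\<close> perm] by blast
  note 1 = pivoted_qrD[OF qr S]
  note Rb = block_carrier[OF 1(4), of k]
  have "det (block11 k R) \<noteq> 0"
  proof
    assume "det (block11 k R) = 0"
    then obtain y where y: "y \<in> carrier_vec k" "y \<noteq> 0\<^sub>v k" "block11 k R *\<^sub>v y = 0\<^sub>v k"
      using det_0_iff_vec_prod_zero[OF Rb(1)] by auto
    let ?x = "y @\<^sub>v 0\<^sub>v (p - k)"
    have x: "?x \<in> carrier_vec p" using append_carrier_vec[OF y(1) zero_carrier_vec, of "p - k"] \<pi>(2) by simp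
    have "R *\<^sub>v ?x = (block11 k R *\<^sub>v y + block12 k R *\<^sub>v 0\<^sub>v (p - k))
        @\<^sub>v (0\<^sub>m (p - k) k *\<^sub>v y + block22 k R *\<^sub>v 0\<^sub>v (p - k))"
      by (subst upper_triangular_blocks[OF 1(4,5) \<pi>(2)])
        (rule four_block_mat_mult_vec[OF Rb(1,2) zero_carrier_mat Rb(3) y(1) zero_carrier_vec])
    also have "\<dots> = 0\<^sub>v p"
      using y Rb \<pi>(2) by (intro eq_vecI) (auto simp: scalar_prod_def)
    finally have Rx: "R *\<^sub>v ?x = 0\<^sub>v p" .
    have SP: "S * P \<in> carrier_mat n p" using S by (simp add: P_def)
    have "(S * P) *\<^sub>v ?x = Q *\<^sub>v (R *\<^sub>v ?x)" unfolding 1(7) by (rule assoc_mult_mat_vec[OF 1(2,4) x])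
    also have "\<dots> = 0\<^sub>v n" unfolding Rx using 1(2) by (intro eq_vecI) auto
    finally have SPx: "(S * P) *\<^sub>v ?x = 0\<^sub>v n" .
    have lt: "\<pi> b < p" if "b < p" for b using permutes_in_image[OF \<pi>(1)] that by simp
    have entry: "(S * P) $$ (a, b) = S $$ (a, \<pi> b)" if "a < n" "b < p" for a b
    proof -
      have "col P b = unit_vec p (\<pi> b)"
        using that lt[OF that(2)] by (intro eq_vecI) (auto simp: P_def)
      then have "(S * P) $$ (a, b) = row S a \<bullet> unit_vec p (\<pi> b)" using that S by (simp add: P_def)
      then show ?thesis using lt[OF that(2)] that S by simp
    qed
    have "mat n k (\<lambda>(a, b). S $$ (a, \<pi> b)) *\<^sub>v y = (S * P) *\<^sub>v ?x"
    proof (rule eq_vecI)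
      fix a assume "a < dim_vec ((S * P) *\<^sub>v ?x)"
      then have a: "a < n" using S by simp
      have "((S * P) *\<^sub>v ?x) $ a = (\<Sum>b<p. S $$ (a, \<pi> b) * ?x $ b)"
      proof -
        define M where "M = S * P"
        have M: "M \<in> carrier_mat n p" "\<And>b. b < p \<Longrightarrow> M $$ (a, b) = S $$ (a, \<pi> b)"
          using SP entry[OF a] by (auto simp: M_def)
        have "(M *\<^sub>v ?x) $ a = (\<Sum>b<p. M $$ (a, b) * ?x $ b)"
          using M(1) a x y(1) \<pi>(2) by (auto simp: scalar_prod_def lessThan_atLeast0 intro!: sum.cong)
        then show ?thesis by (simp add: M M_def[symmetric])
      qed
      also have "\<dots> = (\<Sum>b<k. S $$ (a, \<pi> b) * ?x $ b)"
        using y \<pi>(2) by (intro sum.mono_neutral_right) auto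
      also have "\<dots> = (mat n k (\<lambda>(a, b). S $$ (a, \<pi> b)) *\<^sub>v y) $ a"
        using a y by (auto simp: scalar_prod_def lessThan_atLeast0 intro!: sum.cong)
      finally show "(mat n k (\<lambda>(a, b). S $$ (a, \<pi> b)) *\<^sub>v y) $ a = ((S * P) *\<^sub>v ?x) $ a" by simp
    qed (use S in auto)
    then show False using ind[OF y(1)] y(2) SPx by simp
  qed
  then have "invertible_mat (block11 k R)" using invertible_mat_iff_det[OF Rb(1)] by simp
  then show ?thesis using qr by (intro exI[of _ "(P, Q, R)"]) (simp add: srrqr_initial_def)
qed

section \<open>The bounds at termination\<close>

text \<open>
  \<open>R\<^sup>T R = P\<^sup>T (S\<^sup>T S) P\<close> is similar to \<open>S\<^sup>T S\<close>.
\<close>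
lemma singular_value_pivoted_qr:
  assumes S: "S \<in> carrier_mat n p" and "p \<le> n" and qr: "pivoted_qr S P Q R"
  shows "singular_value i R = singular_value i S"
proof -
  note 1 = pivoted_qrD[OF qr S]
  note P = permutation_mat_orthogonal[OF 1(1)]
  let ?G = "transpose_mat S * S"
  have G: "?G \<in> carrier_mat p p" using S by simp
  have "transpose_mat R * R = transpose_mat R * ((transpose_mat Q * Q) * R)" using 1 by simp
  also have "\<dots> = transpose_mat (Q * R) * (Q * R)"
    using 1(2,4) by (simp add: transpose_mult[of _ n p] assoc_mult_mat[of _ p p _ n _ p]
          assoc_mult_mat[of _ p n _ p _ p])
  also have "\<dots> = transpose_mat P * ?G * P"
    unfolding 1(7)[symmetric] using S P(1)
    by (simp add: transpose_mult[of _ n p] assoc_mult_mat[of _ p p _ n _ p]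
          assoc_mult_mat[of _ p n _ p _ p] assoc_mult_mat[of _ p p _ p _ p])
  finally have RR: "transpose_mat R * R = transpose_mat P * ?G * P" .
  have "similar_mat (transpose_mat R * R) ?G"
    by (rule similar_matI[of _ _ "transpose_mat P" P p])
      (use RR G P 1(4) orthogonal_mat_right[OF P] in auto)
  then have "char_poly (transpose_mat R * R) = char_poly ?G" by (rule char_poly_similar)
  then show ?thesis
    unfolding singular_value_def singular_values_def using S 1(4) \<open>p \<le> n\<close> by simp
qed

text \<open>
  Summing \<open>\<rho>\<^sub>i\<^sub>j\<^sup>2\<close> over all \<open>i\<close> and \<open>j\<close> gives the squared Frobenius norm of \<open>R11\<^sup>-\<^sup>1 R12\<close> plus the
  product of the squared Frobenius norms of \<open>R11\<^sup>-\<^sup>1\<close>, taken row by row, and of \<open>R22\<close>, taken column by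
  column.
\<close>
lemma srrqr_rho_bound:
  fixes R :: "real mat"
  assumes R: "R \<in> carrier_mat p p" and inv: "invertible_mat (block11 k R)"
    and \<rho>: "\<And>i j. i < k \<Longrightarrow> j < p - k \<Longrightarrow> srrqr_rho k R i j \<le> f"
  defines "N \<equiv> the (mat_inverse (block11 k R))"
  shows "1 + frob2 (N * block12 k R) + frob2 N * frob2 (block22 k R)
      \<le> 1 + f\<^sup>2 * real k * real (p - k)"
    and "\<And>i j. i < k \<Longrightarrow> j < p - k \<Longrightarrow> \<bar>(N * block12 k R) $$ (i, j)\<bar> \<le> f"
proof -
  note Rb = block_carrier[OF R, of k]
  have N: "N \<in> carrier_mat k k" unfolding N_def by (rule the_mat_inverse[OF Rb(1) inv])
  have X: "N * block12 k R \<in> carrier_mat k (p - k)" using N Rb by simp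
  have nonneg: "0 \<le> srrqr_rho k R i j" for i j by (simp add: srrqr_rho_def Let_def)
  have le: "(srrqr_rho k R i j)\<^sup>2 \<le> f\<^sup>2" if "i < k" "j < p - k" for i j
    using \<rho>[OF that] nonneg by (simp add: power_mono)
  have "frob2 (N * block12 k R) + frob2 N * frob2 (block22 k R)
      = (\<Sum>i<k. \<Sum>j<p - k. (srrqr_rho k R i j)\<^sup>2)"
    unfolding srrqr_rho_square N_def[symmetric] frob2_entries[OF X] frob2_cols[OF Rb(3)]
    using N by (simp add: frob2_def sum.distrib sum_product mult.commute)
  also have "\<dots> \<le> (\<Sum>i<k. \<Sum>j<p - k. f\<^sup>2)" by (intro sum_mono le) auto
  finally show "1 + frob2 (N * block12 k R) + frob2 N * frob2 (block22 k R)
      \<le> 1 + f\<^sup>2 * real k * real (p - k)" by (simp add: mult_ac)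
  fix i j assume ij: "i < k" "j < p - k"
  have "((N * block12 k R) $$ (i, j))\<^sup>2 \<le> (srrqr_rho k R i j)\<^sup>2"
    unfolding srrqr_rho_square N_def[symmetric] by (simp add: scalar_prod_self_nonneg)
  then have "\<bar>(N * block12 k R) $$ (i, j)\<bar> \<le> srrqr_rho k R i j"
    using nonneg by (simp add: abs_le_square_iff[symmetric])
  then show "\<bar>(N * block12 k R) $$ (i, j)\<bar> \<le> f" using \<rho>[OF ij] by linarith
qed

lemma srrqr_output_rho_le:
  assumes "srrqr_output S k f P Q R" and "dim_col R = p" and "i < k" and "j < p - k"
  shows "srrqr_rho k R i j \<le> f"
proof -
  let ?A = "{srrqr_rho k R i j | i j. i < k \<and> j < dim_col R - k}"
  have "?A = (\<lambda>(i, j). srrqr_rho k R i j) ` ({..<k} \<times> {..<dim_col R - k})" by auto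
  then have "finite ?A" by simp
  moreover have "srrqr_rho k R i j \<in> ?A" using assms by blast
  ultimately have "srrqr_rho k R i j \<le> Max ?A" by (rule Max_ge)
  then show ?thesis using assms(1) unfolding srrqr_output_def by linarith
qed

lemma split_cols:
  assumes "A \<in> carrier_mat n p" and "k \<le> p"
  obtains A1 A2 where "A1 \<in> carrier_mat n k" "A2 \<in> carrier_mat n (p - k)" "A = append_cols A1 A2"
proof
  show "mat n k (\<lambda>(i, j). A $$ (i, j)) \<in> carrier_mat n k"
    "mat n (p - k) (\<lambda>(i, j). A $$ (i, j + k)) \<in> carrier_mat n (p - k)" by auto
  show "A = append_cols (mat n k (\<lambda>(i, j). A $$ (i, j))) (mat n (p - k) (\<lambda>(i, j). A $$ (i, j + k)))"
    unfolding append_cols_def using assms by (intro eq_matI) auto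
qed

theorem theorem4p4:
  fixes S :: "real mat" and n p k :: nat and f :: real
  assumes "S \<in> carrier_mat n p" and "p \<le> n"
    and "1 \<le> k" and "k < p"
    and "k \<le> vec_space.rank n S"
    and "1 \<le> f"
  shows
    \<comment> \<open>the algorithm can be started, and every iteration can be carried out\<close>
    "(\<exists>s. srrqr_initial S k s) \<and>
     (\<forall>P Q R. srrqr_reachable S k f (P, Q, R) \<longrightarrow>
        invertible_mat (block11 k R) \<and>
        (\<forall>i<k. \<forall>j<p - k. srrqr_rho k R i j > f \<longrightarrow>
           (\<exists>Qt Rt. unpivoted_qr (R * swaprows_mat p i (j + k)) Qt Rt))) \<and>
     srrqr_terminates S k f \<and>
     (\<forall>P Q R. srrqr_output S k f P Q R \<longrightarrow>
        pivoted_qr S P Q R \<and>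
        (\<exists>S1 S2 Q1 Q2 R11 R12 R22.
           S1 \<in> carrier_mat n k \<and> S2 \<in> carrier_mat n (p - k) \<and>
           Q1 \<in> carrier_mat n k \<and> Q2 \<in> carrier_mat n (p - k) \<and>
           R11 \<in> carrier_mat k k \<and> R12 \<in> carrier_mat k (p - k) \<and>
           R22 \<in> carrier_mat (p - k) (p - k) \<and>
           S * P = append_cols S1 S2 \<and>
           Q = append_cols Q1 Q2 \<and>
           R = four_block_mat R11 R12 (0\<^sub>m (p - k) k) R22 \<and>
           invertible_mat R11 \<and>
           (\<forall>i\<in>{1..k}. singular_value i R11 \<ge>
              singular_value i S / sqrt (1 + f\<^sup>2 * real k * real (p - k))) \<and>
           (\<forall>j\<in>{1..p - k}. singular_value j R22 \<le>
              singular_value (j + k) S * sqrt (1 + f\<^sup>2 * real k * real (p - k))) \<and>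
           (\<forall>i<k. \<forall>j<p - k. \<bar>(the (mat_inverse R11) * R12) $$ (i, j)\<bar> \<le> f)))"
proof (intro conjI allI impI)
  note S = assms(1)
  let ?C = "1 + f\<^sup>2 * real k * real (p - k)"
  show "\<exists>s. srrqr_initial S k s" by (rule srrqr_initial_exists) fact+
  show "srrqr_terminates S k f" by (rule srrqr_terminates) fact+
  {
    fix P Q R assume reach: "srrqr_reachable S k f (P, Q, R)"
    note inv = srrqr_reachable_invariant[OF S \<open>1 \<le> f\<close> reach]
    show "invertible_mat (block11 k R)" by (rule inv)
    fix i j
    have "R * swaprows_mat p i (j + k) \<in> carrier_mat p p" using pivoted_qrD(4)[OF inv(1) S] by simp
    then show "\<exists>Qt Rt. unpivoted_qr (R * swaprows_mat p i (j + k)) Qt Rt"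
      by (rule unpivoted_qr_exists) simp
  }
  fix P Q R assume out: "srrqr_output S k f P Q R"
  then have reach: "srrqr_reachable S k f (P, Q, R)" by (simp add: srrqr_output_def)
  note inv = srrqr_reachable_invariant[OF S \<open>1 \<le> f\<close> reach]
  note qr = pivoted_qrD[OF inv(1) S]
  show "pivoted_qr S P Q R" by (rule inv)
  let ?N = "the (mat_inverse (block11 k R))"
  note Rb = block_carrier[OF qr(4), of k]
  note N = the_mat_inverse[OF Rb(1) inv(2)]
  have "dim_col R = p" using qr(4) by simp
  note bound = srrqr_rho_bound[OF qr(4) inv(2) srrqr_output_rho_le[OF out this]]
  have R_eq: "R = four_block_mat (block11 k R) (block12 k R) (0\<^sub>m (p - k) k) (block22 k R)"
    using upper_triangular_blocks[OF qr(4,5)] \<open>k < p\<close> by simp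
  let ?c = "1 + frob2 (?N * block12 k R) + frob2 ?N * frob2 (block22 k R)"
  have sqrt_le: "sqrt ?c \<le> sqrt ?C" using bound(1) by simp
  have "0 < ?C" by (simp add: add_pos_nonneg)
  then have pos: "0 < sqrt ?C" by simp
  have sv: "singular_value i R = singular_value i S" for i
    by (rule singular_value_pivoted_qr[OF S \<open>p \<le> n\<close> inv(1)])
  have le11: "singular_value i S / sqrt ?C \<le> singular_value i (block11 k R)" if i: "i \<in> {1..k}" for i
  proof -
    have "singular_value i R \<le> singular_value i (block11 k R) * sqrt ?c"
      by (subst R_eq, rule singular_value_R_le_R11[OF Rb N]) (use i in auto)
    also have "\<dots> \<le> singular_value i (block11 k R) * sqrt ?C"
      using singular_value_nonneg[OF Rb(1)] i by (intro mult_left_mono sqrt_le) auto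
    finally show ?thesis using pos by (simp add: sv pos_divide_le_eq)
  qed
  have le22: "singular_value j (block22 k R) \<le> singular_value (j + k) S * sqrt ?C"
    if j: "j \<in> {1..p - k}" for j
  proof -
    have "singular_value j (block22 k R) \<le> singular_value (j + k) R * sqrt ?c"
      by (subst (2) R_eq, rule singular_value_R22_le_R[OF Rb N]) (use j in auto)
    also have "\<dots> \<le> singular_value (j + k) R * sqrt ?C"
      using singular_value_nonneg[OF qr(4)] j by (intro mult_left_mono sqrt_le) auto
    finally show ?thesis by (simp add: sv)
  qed
  have SP: "S * P \<in> carrier_mat n p" unfolding qr(7) using qr by simp
  obtain S1 S2 where S12: "S1 \<in> carrier_mat n k" "S2 \<in> carrier_mat n (p - k)" "S * P = append_cols S1 S2"
    using split_cols[OF SP, of k] \<open>k < p\<close> by auto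
  obtain Q1 Q2 where Q12: "Q1 \<in> carrier_mat n k" "Q2 \<in> carrier_mat n (p - k)" "Q = append_cols Q1 Q2"
    using split_cols[OF qr(2), of k] \<open>k < p\<close> by auto
  show "\<exists>S1 S2 Q1 Q2 R11 R12 R22.
           S1 \<in> carrier_mat n k \<and> S2 \<in> carrier_mat n (p - k) \<and>
           Q1 \<in> carrier_mat n k \<and> Q2 \<in> carrier_mat n (p - k) \<and>
           R11 \<in> carrier_mat k k \<and> R12 \<in> carrier_mat k (p - k) \<and>
           R22 \<in> carrier_mat (p - k) (p - k) \<and>
           S * P = append_cols S1 S2 \<and>
           Q = append_cols Q1 Q2 \<and>
           R = four_block_mat R11 R12 (0\<^sub>m (p - k) k) R22 \<and>
           invertible_mat R11 \<and>
           (\<forall>i\<in>{1..k}. singular_value i R11 \<ge>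
              singular_value i S / sqrt (1 + f\<^sup>2 * real k * real (p - k))) \<and>
           (\<forall>j\<in>{1..p - k}. singular_value j R22 \<le>
              singular_value (j + k) S * sqrt (1 + f\<^sup>2 * real k * real (p - k))) \<and>
           (\<forall>i<k. \<forall>j<p - k. \<bar>(the (mat_inverse R11) * R12) $$ (i, j)\<bar> \<le> f)"
    by (rule exI[of _ S1], rule exI[of _ S2], rule exI[of _ Q1], rule exI[of _ Q2],
        rule exI[of _ "block11 k R"], rule exI[of _ "block12 k R"], rule exI[of _ "block22 k R"])
      (intro conjI ballI allI impI S12 Q12 Rb R_eq inv(2) le11 le22 bound(2))
qed

end
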